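(* Let $\{R,F\}$ be a compatible pair of R-matrices on $V\otimes V$ and let $R_f:=F^{-1}RF$ be the twisted R-matrix. Then: (a) if $F$ is strict skew invertible then $$(R_f)_{12}=\mathrm{Tr}_{(34)}\big(F_{32}^{-1}\,(C_{F^{-1}})_3\,R_{34}\,(D_F)_4\,F_{14}\big);$$ (b) if $R$ is skew invertible and $F$ is strict skew invertible then $R_f$ is skew invertible, with skew inverse $$(\Psi_{R_f})_{12}=(C_{F^{-1}})_2\,\mathrm{Tr}_{(34)}\big(F_{23}^{-1}(\Psi_R)_{34}F_{41}\big)(D_F)_1;$$ moreover $$(\Psi_{R_f})_{12}=(C_{F^{-1}})_2\,F_{21}\,(D_{F^{-1}})_2\,(\Psi_R)_{12}\,(C_F)_1\,F_{21}^{-1}\,(D_F)_1;$$ (c) under the conditions of (b), $$C_{R_f}=C_{F^{-1}}D_RC_F,\qquad D_{R_f}=D_{F^{-1}}C_RD_F$$ (thus, if in addition $R$ is strict skew invertible, then $R_f$ is strict skew invertible as well).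
   Context: $V$ is a finite dimensional complex vector space, $P$ the flip on $V\otimes V$. For $X\in\mathrm{End}(V^{\otimes2})$, $X_{mr}$ ($m\neq r$) is $X$ acting with its first leg in the $m$-th and second leg in the $r$-th tensor factor of $V^{\otimes n}$ and trivially elsewhere (so $X_{21}=P_{12}X_{12}P_{12}$), $X_m:=X_{m\,m+1}$, and $X^{-1}_{mr}=(X^{-1})_{mr}$; for $Y\in\mathrm{End}(V)$, $Y_m$ is $Y$ acting in factor $m$. $\mathrm{Tr}_{(i)}$ is the trace over the $i$-th factor, $\mathrm{Tr}_{(34)}=\mathrm{Tr}_{(3)}\mathrm{Tr}_{(4)}$. $X$ is skew invertible if there is $\Psi_X\in\mathrm{End}(V^{\otimes2})$ (its skew inverse) with $\mathrm{Tr}_{(2)}X_{12}(\Psi_X)_{23}=\mathrm{Tr}_{(2)}(\Psi_X)_{12}X_{23}=P_{13}$; then $C_X:=\mathrm{Tr}_{(1)}(\Psi_X)_{12}$, $D_X:=\mathrm{Tr}_{(2)}(\Psi_X)_{12}\in\mathrm{End}(V)$. $X$ is strict skew invertible if it is skew invertible and $C_X$ or $D_X$ is invertible. (For an R-matrix $X$, strict skew invertibility is equivalent to skew invertibility of both $X$ and $X^{-1}$, and then $C_{X^{-1}}=D_X^{-1}$, $D_{X^{-1}}=C_X^{-1}$.) An R-matrix is an invertible $R\in\mathrm{End}(V^{\otimes2})$ with $R_1R_2R_1=R_2R_1R_2$. A pair $\{R,F\}$ is a compatible pair of R-matrices if $R,F$ are R-matrices and $R_1F_2F_1=F_2F_1R_2$,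 $R_2F_1F_2=F_1F_2R_1$; in this case $R_f$ is again an R-matrix. *)

theory Defs
  imports "HOL-Analysis.Analysis"
begin

(* V is the space with basis indexed by 'n, so End(V) is complex^'n^'n and
   End(V (x) V) is complex^('n * 'n)^('n * 'n), where the entry at row (i,j) and column (k,l)
   is the coefficient of e_i (x) e_j in the image of e_k (x) e_l.

   A tensor power of V whose factors are labelled by a finite type 'l has the basis 'l => 'n.
   Labels 1,...,n are taken from the numeral type n (in which n = 0; the labels 1,...,n are
   pairwise distinct). *)

type_synonym 'n end1 = "complex^'n^'n"
type_synonym 'n end2 = "complex^('n \<times> 'n)^('n \<times> 'n)"
type_synonym ('n, 'l) endT = "complex^('l \<Rightarrow> 'n)^('l \<Rightarrow> 'n)"

definition flip :: "'n::finite end2" where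
  "flip = (\<chi> p q. if p = (snd q, fst q) then 1 else 0)"

(* X_{mr}; only meaningful for m \<noteq> r *)
definition on_factors :: "'l \<Rightarrow> 'l \<Rightarrow> 'n::finite end2 \<Rightarrow> ('n, 'l::finite) endT" where
  "on_factors m r X = (\<chi> a b.
     if \<forall>k. k \<noteq> m \<and> k \<noteq> r \<longrightarrow> a k = b k then X $ (a m, a r) $ (b m, b r) else 0)"

(* Y_m *)
definition on_factor :: "'l \<Rightarrow> 'n::finite end1 \<Rightarrow> ('n, 'l::finite) endT" where
  "on_factor m Y = (\<chi> a b. if \<forall>k. k \<noteq> m \<longrightarrow> a k = b k then Y $ a m $ b m else 0)"

(* The trace over the i-th factor. As in the notation X_{mr}, the resulting operator on the
   remaining factors is regarded as an operator on the whole tensor power that acts trivially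
   in factor i. *)
definition Tr_factor :: "'l \<Rightarrow> ('n::finite, 'l::finite) endT \<Rightarrow> ('n, 'l) endT" where
  "Tr_factor i M = (\<chi> a b.
     if a i = b i then \<Sum>c\<in>UNIV. M $ (a(i := c)) $ (b(i := c)) else 0)"

(* The identification of operators on the factors m, r with operators on the whole tensor
   power loses nothing. *)
lemma on_factors_inject:
  fixes X Y :: "'n::finite end2" and m r :: "'l::finite"
  assumes "m \<noteq> r"
  shows "on_factors m r X = on_factors m r Y \<longleftrightarrow> X = Y"
proof
  assume eq: "on_factors m r X = on_factors m r Y"
  have "X $ (i, j) $ (k, l) = Y $ (i, j) $ (k, l)" for i j k l
  proof -
    let ?a = "(\<lambda>_. i)(r := j)" and ?b = "(\<lambda>_. i)(m := k, r := l)"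
    have "on_factors m r X $ ?a $ ?b = on_factors m r Y $ ?a $ ?b"
      by (simp only: eq)
    then show ?thesis
      using assms by (simp add: on_factors_def)
  qed
  then show "X = Y"
    by (simp add: vec_eq_iff)
qed simp

(* The traces over the first and the second factor of V (x) V. *)
definition Tr1 :: "'n::finite end2 \<Rightarrow> 'n end1" where
  "Tr1 X = (\<chi> i j. \<Sum>c\<in>UNIV. X $ (c, i) $ (c, j))"

definition Tr2 :: "'n::finite end2 \<Rightarrow> 'n end1" where
  "Tr2 X = (\<chi> i j. \<Sum>c\<in>UNIV. X $ (i, c) $ (j, c))"

definition is_skew_inverse :: "'n::finite end2 \<Rightarrow> 'n end2 \<Rightarrow> bool" where
  "is_skew_inverse X \<Psi> \<longleftrightarrow>
     Tr_factor 2 (on_factors 1 2 X ** on_factors 2 3 \<Psi>) = (on_factors 1 3 flip :: ('n, 3) endT) \<and>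
     Tr_factor 2 (on_factors 1 2 \<Psi> ** on_factors 2 3 X) = (on_factors 1 3 flip :: ('n, 3) endT)"

definition skew_invertible :: "'n::finite end2 \<Rightarrow> bool" where
  "skew_invertible X \<longleftrightarrow> (\<exists>\<Psi>. is_skew_inverse X \<Psi>)"

(* A skew inverse is unique if it exists: the two equations say that, after a reshuffling of
   indices, it is a two-sided inverse matrix. *)
definition skew_inverse :: "'n::finite end2 \<Rightarrow> 'n end2" where
  "skew_inverse X = (THE \<Psi>. is_skew_inverse X \<Psi>)"

definition C_op :: "'n::finite end2 \<Rightarrow> 'n end1" where
  "C_op X = Tr1 (skew_inverse X)"

definition D_op :: "'n::finite end2 \<Rightarrow> 'n end1" where
  "D_op X = Tr2 (skew_inverse X)"

definition strict_skew_invertible :: "'n::finite end2 \<Rightarrow> bool" where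
  "strict_skew_invertible X \<longleftrightarrow>
     skew_invertible X \<and> (invertible (C_op X) \<or> invertible (D_op X))"

definition R_matrix :: "'n::finite end2 \<Rightarrow> bool" where
  "R_matrix R \<longleftrightarrow> invertible R \<and>
     (let R1 = on_factors 1 2 R :: ('n, 3) endT; R2 = on_factors 2 3 R
      in R1 ** R2 ** R1 = R2 ** R1 ** R2)"

definition compatible_pair :: "'n::finite end2 \<Rightarrow> 'n end2 \<Rightarrow> bool" where
  "compatible_pair R F \<longleftrightarrow> R_matrix R \<and> R_matrix F \<and>
     (let R1 = on_factors 1 2 R :: ('n, 3) endT; R2 = on_factors 2 3 R;
          F1 = on_factors 1 2 F; F2 = on_factors 2 3 F
      in R1 ** F2 ** F1 = F2 ** F1 ** R2 \<and> R2 ** F1 ** F2 = F1 ** F2 ** R1)"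

definition twisted :: "'n::finite end2 \<Rightarrow> 'n end2 \<Rightarrow> 'n end2" where
  "twisted R F = matrix_inv F ** R ** F"

end

theory Submission
  imports Defs "HOL-Combinatorics.Transposition"
begin

text \<open>
  For operators on \<open>V \<otimes> V\<close> the product \<open>X * Y\<close> with \<open>(X * Y)\<^sub>1\<^sub>3 = Tr\<^sub>(\<^sub>2\<^sub>) X\<^sub>1\<^sub>2 Y\<^sub>2\<^sub>3\<close>
  is associative with unit the flip, and a skew inverse is an inverse for it. Inserting
  \<open>Tr\<^sub>(\<^sub>3\<^sub>) F\<^sub>2\<^sub>3 D\<^sub>3 = 1\<close> into \<open>F\<^sup>-\<^sup>1 X F\<close> and pulling the closed third strand through with the
  braid relations gives (a) for every \<open>X\<close>, R-matrix or not, which satisfies the two relations of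
  compatibility with \<open>F\<close>. With \<open>\<Psi>'\<close> the skew inverse of \<open>F\<^sup>-\<^sup>1\<close> and \<open>C' = Tr\<^sub>(\<^sub>1\<^sub>) \<Psi>'\<close>, the case
  \<open>X = R\<close> says that \<open>(R\<^sub>f)\<^sub>2\<^sub>1 = C'\<^sub>1 (\<Psi>\<^sub>F * R * \<Psi>')\<^sub>1\<^sub>2 (D\<^sub>F)\<^sub>2\<close>; inverting this with respect to
  the product gives the first formula of (b). The second one is (a) again, for
  \<open>X\<^sub>1\<^sub>2 = (C\<^sub>F)\<^sub>1\<^sup>-\<^sup>1 (\<Psi>\<^sub>R)\<^sub>2\<^sub>1 (C\<^sub>F)\<^sub>2\<close> and \<open>F\<^sup>-\<^sup>1\<close> in place of \<open>F\<close>.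
\<close>

section \<open>Operators on tensor powers\<close>

text \<open>The last appeal to (a) is the delicate one. The operator put in place of X there is not
  known to be an R-matrix, so both of its braid relations with F must be derived from those of R;
  this takes an exchange identity for the skew inverse of R on three factors. The powers of C_F in
  that operator are dictated by (a): they cancel the two one-factor operators which (a) places
  beside X. Everything rests on consequences of the Yang-Baxter relation for F alone: the skew
  inverse of F is F_21^-1 with D_F, or C_F, and its inverse placed on the legs. Solving this for
  F^-1 produces the skew inverse of F^-1, and its traces give C = D_F^-1 and D = C_F^-1 for F^-1.
  These facts are proved from the invertibility of either trace. Two symmetries save most of the
  duplicate work: exchange of F with F^-1, and reversal of the tensor factors, which interchanges C
  and D. For (c), an outermost F or F^-1 in the contraction product disappears when its strand is
  closed with the matching D_F or C of F^-1; the remaining one is absorbed by a partial trace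
  formula.\<close>

lemma sum_override:
  fixes f :: "('l::finite \<Rightarrow> 'n::finite) \<Rightarrow> 'a::comm_monoid_add"
  assumes "\<And>c k. k \<notin> S \<Longrightarrow> c k \<noteq> a k \<Longrightarrow> f c = 0"
  shows "(\<Sum>c\<in>UNIV. f c) = (\<Sum>u\<in>PiE S (\<lambda>_. UNIV). f (override_on a u S))"
proof -
  have "(\<Sum>c\<in>UNIV. f c) = (\<Sum>c\<in>{c. \<forall>k. k \<notin> S \<longrightarrow> c k = a k}. f c)"
    by (rule sum.mono_neutral_right) (use assms in auto)
  also have "\<dots> = (\<Sum>u\<in>PiE S (\<lambda>_. UNIV). f (override_on a u S))"
    by (rule sum.reindex_bij_witness[where i = "\<lambda>u. override_on a u S" and j = "\<lambda>c. restrict c S"])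
       (auto simp: override_on_def restrict_def fun_eq_iff PiE_def extensional_def intro: arg_cong[where f = f])
  finally show ?thesis .
qed

lemma sum_fun_upd2:
  fixes f :: "('l::finite \<Rightarrow> 'n::finite) \<Rightarrow> 'a::comm_monoid_add"
  assumes "m \<noteq> r" "\<And>c k. k \<noteq> m \<Longrightarrow> k \<noteq> r \<Longrightarrow> c k \<noteq> a k \<Longrightarrow> f c = 0"
  shows "(\<Sum>c\<in>UNIV. f c) = (\<Sum>p\<in>UNIV. f (a(m := fst p, r := snd p)))"
proof -
  have "(\<Sum>c\<in>UNIV. f c) = (\<Sum>c\<in>{c. \<forall>k. k \<noteq> m \<longrightarrow> k \<noteq> r \<longrightarrow> c k = a k}. f c)"
    by (rule sum.mono_neutral_right) (use assms in auto)
  also have "\<dots> = (\<Sum>p\<in>UNIV. f (a(m := fst p, r := snd p)))"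
    using assms(1)
    by (intro sum.reindex_bij_witness[where i = "\<lambda>p. a(m := fst p, r := snd p)" and j = "\<lambda>c. (c m, c r)"])
       (auto simp: fun_eq_iff intro: arg_cong[where f = f])
  finally show ?thesis .
qed

lemma sum_fun_upd1:
  fixes f :: "('l::finite \<Rightarrow> 'n::finite) \<Rightarrow> 'a::comm_monoid_add"
  assumes "\<And>c k. k \<noteq> m \<Longrightarrow> c k \<noteq> a k \<Longrightarrow> f c = 0"
  shows "(\<Sum>c\<in>UNIV. f c) = (\<Sum>x\<in>UNIV. f (a(m := x)))"
proof -
  have "(\<Sum>c\<in>UNIV. f c) = (\<Sum>c\<in>{c. \<forall>k. k \<noteq> m \<longrightarrow> c k = a k}. f c)"
    by (rule sum.mono_neutral_right) (use assms in auto)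
  also have "\<dots> = (\<Sum>x\<in>UNIV. f (a(m := x)))"
    by (intro sum.reindex_bij_witness[where i = "\<lambda>x. a(m := x)" and j = "\<lambda>c. c m"])
       (auto simp: fun_eq_iff intro: arg_cong[where f = f])
  finally show ?thesis .
qed

section \<open>Operators supported on a set of factors\<close>

text \<open>Expresses that M is an operator on the factors in S tensored with the identity
  elsewhere. Working with entries avoids splitting the tensor power into a product.\<close>

definition acts_on :: "'l set \<Rightarrow> ('n::finite, 'l::finite) endT \<Rightarrow> bool" where
  "acts_on S M \<longleftrightarrow>
     (\<forall>a b k. k \<notin> S \<longrightarrow> a k \<noteq> b k \<longrightarrow> M $ a $ b = 0) \<and>
     (\<forall>a b a' b'. (\<forall>k. k \<in> S \<longrightarrow> a k = a' k \<and> b k = b' k) \<longrightarrow>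
        (\<forall>k. k \<notin> S \<longrightarrow> a k = b k \<and> a' k = b' k) \<longrightarrow> M $ a $ b = M $ a' $ b')"

lemma acts_on_zero: "acts_on S M \<Longrightarrow> k \<notin> S \<Longrightarrow> a k \<noteq> b k \<Longrightarrow> M $ a $ b = 0"
  by (auto simp: acts_on_def)

lemma acts_on_cong:
  "acts_on S M \<Longrightarrow> (\<And>k. k \<in> S \<Longrightarrow> a k = a' k) \<Longrightarrow> (\<And>k. k \<in> S \<Longrightarrow> b k = b' k) \<Longrightarrow>
   (\<And>k. k \<notin> S \<Longrightarrow> a k = b k) \<Longrightarrow> (\<And>k. k \<notin> S \<Longrightarrow> a' k = b' k) \<Longrightarrow> M $ a $ b = M $ a' $ b'"
  unfolding acts_on_def by blast

lemma acts_on_mono: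
  fixes M :: "('n::finite, 'l::finite) endT"
  assumes "acts_on S M" "S \<subseteq> T" shows "acts_on T M"
  unfolding acts_on_def
proof (intro conjI allI impI)
  fix a b :: "'l \<Rightarrow> 'n" and k assume "k \<notin> T" "a k \<noteq> b k" then show "M $ a $ b = 0"
    using assms acts_on_zero by blast
next
  fix a b a' b' :: "'l \<Rightarrow> 'n"
  assume 1: "\<forall>k. k \<in> T \<longrightarrow> a k = a' k \<and> b k = b' k" and 2: "\<forall>k. k \<notin> T \<longrightarrow> a k = b k \<and> a' k = b' k"
  show "M $ a $ b = M $ a' $ b'"
  proof (cases "\<exists>k. k \<notin> S \<and> a k \<noteq> b k")
    case True
    then obtain k where "k \<notin> S" "a k \<noteq> b k" by blast
    moreover have "a' k \<noteq> b' k" using calculation 1 2 by metis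
    ultimately show ?thesis using assms acts_on_zero by metis
  next
    case False
    then show ?thesis using 1 2 assms(2)
      by (intro acts_on_cong[OF assms(1)]) (metis subsetD)+
  qed
qed

lemma acts_on_mult_same:
  fixes M N :: "('n::finite, 'l::finite) endT"
  assumes "acts_on S M" "acts_on S N" shows "acts_on S (M ** N)"
proof -
  have e: "(M ** N) $ a $ b = (\<Sum>u\<in>PiE S (\<lambda>_. UNIV). M $ a $ override_on a u S * N $ override_on a u S $ b)" for a b
    unfolding matrix_matrix_mult_def vec_lambda_beta
    by (rule sum_override) (metis acts_on_zero[OF assms(1)] mult_zero_left)
  show ?thesis unfolding acts_on_def
  proof (intro conjI allI impI)
    fix a b :: "'l \<Rightarrow> 'n" and k assume "k \<notin> S" "a k \<noteq> b k"
    then show "(M ** N) $ a $ b = 0" unfolding e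
      by (intro sum.neutral ballI) (simp add: acts_on_zero[OF assms(2)])
  next
    fix a b a' b' :: "'l \<Rightarrow> 'n"
    assume "\<forall>k. k \<in> S \<longrightarrow> a k = a' k \<and> b k = b' k" "\<forall>k. k \<notin> S \<longrightarrow> a k = b k \<and> a' k = b' k"
    then show "(M ** N) $ a $ b = (M ** N) $ a' $ b'" unfolding e
      by (intro sum.cong refl arg_cong2[where f = "(*)"] acts_on_cong[OF assms(1)] acts_on_cong[OF assms(2)])
         (auto simp: override_on_def)
  qed
qed

lemma acts_on_mult: "acts_on S M \<Longrightarrow> acts_on T N \<Longrightarrow> acts_on (S \<union> T) (M ** N)"
  by (intro acts_on_mult_same) (auto elim: acts_on_mono)

lemma acts_on_factors: "acts_on {m, r} (on_factors m r X)"
  unfolding acts_on_def on_factors_def by auto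

lemma acts_on_factor: "acts_on {m} (on_factor m X)"
  unfolding acts_on_def on_factor_def by auto

lemmas acts_on_intros = acts_on_mult acts_on_factors acts_on_factor

section \<open>Traces over sets of factors\<close>

text \<open>With an arbitrary set, one cyclicity statement covers a single trace, a double trace
  and, for the empty set, the commutation of operators with disjoint supports.\<close>

definition Tr_set :: "'l set \<Rightarrow> ('n::finite, 'l::finite) endT \<Rightarrow> ('n, 'l) endT" where
  "Tr_set I M = (\<chi> a b. if \<forall>k\<in>I. a k = b k
     then \<Sum>u\<in>PiE I (\<lambda>_. UNIV). M $ override_on a u I $ override_on b u I else 0)"

text \<open>Outside I the middle index of either product is forced, because at each label one of the
  two operators acts trivially. What remains is a double sum over assignments u, v to I; swapping
  the sums swaps the operators.\<close>

lemma Tr_set_cyclic: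
  assumes M: "acts_on S M" and N: "acts_on T N" and I: "S \<inter> T \<subseteq> I"
  shows "Tr_set I (M ** N) = Tr_set I (N ** M)"
proof -
  \<comment> \<open>Outside I the middle index equals b on S, where N acts trivially, and a off S,
    where M does. This is \<open>override_on a b S\<close>, so only the values v on I are
    summed.\<close>
  have e: "(M ** N) $ override_on a u I $ override_on b u I =
     (\<Sum>v\<in>PiE I (\<lambda>_. UNIV). M $ override_on a u I $ override_on (override_on a b S) v I *
         N $ override_on (override_on a b S) v I $ override_on b u I)"
    if M: "acts_on S M" and N: "acts_on T N" and I: "S \<inter> T \<subseteq> I" for M N S T a b u
    unfolding matrix_matrix_mult_def vec_lambda_beta
  proof (rule sum_override)
    fix c k assume k: "k \<notin> I" "c k \<noteq> override_on a b S k"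
    show "M $ override_on a u I $ c * N $ c $ override_on b u I = 0"
    proof (cases "k \<in> S")
      case True
      then have "k \<notin> T" using I k by auto
      then have "N $ c $ override_on b u I = 0" using True k by (intro acts_on_zero[OF N]) auto
      then show ?thesis by simp
    next
      case False
      then have "M $ override_on a u I $ c = 0" using k by (intro acts_on_zero[OF M, of k]) auto
      then show ?thesis by simp
    qed
  qed
  have I': "T \<inter> S \<subseteq> I" using I by auto
  \<comment> \<open>Either both products vanish, since indices differ at a label where an operator
    acts trivially, or the factors agree one by one.\<close>
  have "M $ override_on a u I $ override_on (override_on a b S) v I *
         N $ override_on (override_on a b S) v I $ override_on b u I =
        N $ override_on a v I $ override_on (override_on a b T) u I *
         M $ override_on (override_on a b T) u I $ override_on b v I"
    (is "?M1 * ?N1 = ?N2 * ?M2")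
    if ab: "\<forall>k\<in>I. a k = b k" for a b u v
  proof (cases "\<exists>k. k \<notin> S \<union> T \<union> I \<and> a k \<noteq> b k")
    case True
    then obtain k where "k \<notin> S \<union> T \<union> I" "a k \<noteq> b k" by blast
    then have "?N1 = 0" "?M2 = 0"
      by (auto intro: acts_on_zero[OF N, of k] acts_on_zero[OF M, of k])
    then show ?thesis by simp
  next
    case False
    show ?thesis
    proof (cases "(\<exists>k. k \<in> I - S \<and> u k \<noteq> v k) \<or> (\<exists>k. k \<in> I - T \<and> u k \<noteq> v k)")
      case True
      then obtain k where k: "k \<in> I" "u k \<noteq> v k" "k \<notin> S \<or> k \<notin> T" by blast
      then have "(?M1 = 0 \<or> ?N1 = 0) \<and> (?M2 = 0 \<or> ?N2 = 0)"
        using acts_on_zero[OF M, of k] acts_on_zero[OF N, of k] by (metis override_on_apply_in)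
      then show ?thesis by auto
    next
      case 2: False
      have "?M1 = ?M2" using False 2 I
        by (intro acts_on_cong[OF M]) (auto simp: override_on_def)
      moreover have "?N1 = ?N2" using False 2 I
        by (intro acts_on_cong[OF N]) (auto simp: override_on_def)
      ultimately show ?thesis by simp
    qed
  qed
  note * = this
  have "Tr_set I (M ** N) $ a $ b = Tr_set I (N ** M) $ a $ b" for a b
  proof (cases "\<forall>k\<in>I. a k = b k")
    case True
    then show ?thesis
      unfolding Tr_set_def vec_lambda_beta e[OF M N I] e[OF N M I'] if_P[OF True]
      by (subst sum.swap) (intro sum.cong refl *)
  qed (auto simp: Tr_set_def)
  then show ?thesis by (simp add: vec_eq_iff)
qed

lemma Tr_set_empty: "Tr_set {} M = M"
  by (simp add: Tr_set_def vec_eq_iff)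

lemma Tr_set_singleton: "Tr_set {i} M = Tr_factor i M"
proof -
  have "(\<Sum>u\<in>PiE {i} (\<lambda>_. UNIV). M $ override_on a u {i} $ override_on b u {i}) =
     (\<Sum>c\<in>UNIV. M $ (a(i := c)) $ (b(i := c)))" for a b
    by (rule sum.reindex_bij_witness[where i = "\<lambda>c. restrict (\<lambda>_. c) {i}" and j = "\<lambda>u. u i"])
       (auto simp: override_on_def restrict_def fun_eq_iff PiE_def extensional_def
         intro!: arg_cong2[where f = "\<lambda>x y. M $ x $ y"])
  then show ?thesis unfolding Tr_set_def Tr_factor_def vec_eq_iff vec_lambda_beta by simp
qed

lemma Tr_set_pair:
  assumes "i \<noteq> j" shows "Tr_set {i, j} M = Tr_factor i (Tr_factor j M)"
proof -
  have "(\<Sum>u\<in>PiE {i,j} (\<lambda>_. UNIV). M $ override_on a u {i,j} $ override_on b u {i,j}) =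
     (\<Sum>(c,d)\<in>UNIV\<times>UNIV. M $ (a(i := c, j := d)) $ (b(i := c, j := d)))" for a b
    using assms
    by (intro sum.reindex_bij_witness[where i = "\<lambda>(c,d). restrict (\<lambda>k. if k = i then c else d) {i,j}" and j = "\<lambda>u. (u i, u j)"])
       (auto simp: override_on_def restrict_def fun_eq_iff PiE_def extensional_def
         intro!: arg_cong2[where f = "\<lambda>x y. M $ x $ y"])
  then show ?thesis using assms
    by (auto simp: Tr_set_def Tr_factor_def vec_eq_iff sum.cartesian_product)
qed

lemma mult_commute_disjoint:
  "acts_on S M \<Longrightarrow> acts_on T N \<Longrightarrow> S \<inter> T = {} \<Longrightarrow> M ** N = N ** M"
  using Tr_set_cyclic[of S M T N "{}"] by (simp add: Tr_set_empty)

lemma Tr_factor_cyclic: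
  "acts_on S M \<Longrightarrow> acts_on T N \<Longrightarrow> S \<inter> T \<subseteq> {i} \<Longrightarrow> Tr_factor i (M ** N) = Tr_factor i (N ** M)"
  using Tr_set_cyclic[of S M T N "{i}"] by (simp add: Tr_set_singleton)

lemma Tr_factor_cyclic2:
  "acts_on S M \<Longrightarrow> acts_on T N \<Longrightarrow> S \<inter> T \<subseteq> {i, j} \<Longrightarrow> i \<noteq> j \<Longrightarrow>
   Tr_factor i (Tr_factor j (M ** N)) = Tr_factor i (Tr_factor j (N ** M))"
  using Tr_set_cyclic[of S M T N "{i, j}"] by (simp add: Tr_set_pair)

lemma Tr_factor_commute: "Tr_factor i (Tr_factor j M) = Tr_factor j (Tr_factor i M)"
proof (cases "i = j")
  case False
  then show ?thesis using Tr_set_pair[of i j M] Tr_set_pair[of j i M] by (metis insert_commute)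
qed simp

lemma sum_fibre:
  fixes f :: "('l::finite \<Rightarrow> 'n::finite) \<Rightarrow> 'a::comm_monoid_add"
  shows "(\<Sum>c\<in>UNIV. f c) = (\<Sum>c\<in>{c. c i = z}. \<Sum>t\<in>UNIV. f (c(i := t)))"
  unfolding sum.cartesian_product
  by (rule sum.reindex_bij_witness[where i = "\<lambda>(c,t). c(i := t)" and j = "\<lambda>c. (c(i := z), c i)"])
     (auto simp: fun_eq_iff intro: arg_cong[where f = f])

lemma Tr_factor_mult_left:
  assumes M: "acts_on S M" and i: "i \<notin> S"
  shows "Tr_factor i (M ** N) = M ** Tr_factor i N"
proof -
  have "(\<Sum>t\<in>UNIV. (M ** N) $ (a(i := t)) $ (b(i := t))) = (\<Sum>c\<in>{c. c i = a i}. M $ a $ c * (\<Sum>t\<in>UNIV. N $ (c(i := t)) $ (b(i := t))))" for a b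
  proof -
    have "(M ** N) $ (a(i := t)) $ (b(i := t)) = (\<Sum>c\<in>{c. c i = a i}. M $ a $ c * N $ (c(i := t)) $ (b(i := t)))" for t
    proof -
      \<comment> \<open>The condition \<open>c i = a i\<close> picks one representative among index
        functions that differ only at i. As M is trivial in factor i, the middle index must carry
        the traced value t there.\<close>
      have "M $ (a(i := t)) $ (c(i := s)) = (if s = t then M $ a $ c else 0)" if "c i = a i" for c s
      proof (cases "s = t")
        case True
        have "M $ (a(i := t)) $ (c(i := t)) = M $ a $ c"
        proof (cases "\<exists>k. k \<notin> S \<and> a k \<noteq> c k")
          case True
          then show ?thesis using that acts_on_zero[OF M]
            by (smt (verit, best) fun_upd_other)
        next
          case False
          then show ?thesis using i by (intro acts_on_cong[OF M]) auto
        qed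
        then show ?thesis using True by simp
      next
        case False
        then show ?thesis using acts_on_zero[OF M i, of "a(i := t)" "c(i := s)"] by auto
      qed
      then have "(M ** N) $ (a(i := t)) $ (b(i := t)) = (\<Sum>c\<in>{c. c i = a i}. \<Sum>s\<in>UNIV.
         (if s = t then M $ a $ c else 0) * N $ (c(i := s)) $ (b(i := t)))"
        unfolding matrix_matrix_mult_def vec_lambda_beta
        by (subst sum_fibre[where i = i and z = "a i"]) simp
      then show ?thesis by (simp add: if_distrib[where f = "\<lambda>x. x * _"] cong: if_cong)
    qed
    then show ?thesis by (simp add: sum_distrib_left sum.swap[where A = UNIV])
  qed
  moreover have "(M ** Tr_factor i N) $ a $ b =
     (\<Sum>c\<in>{c. c i = a i}. M $ a $ c * (if a i = b i then \<Sum>t\<in>UNIV. N $ (c(i := t)) $ (b(i := t)) else 0))" for a b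
    unfolding matrix_matrix_mult_def Tr_factor_def vec_lambda_beta
    by (rule trans[OF sum.mono_neutral_right[where S = "{c. c i = a i}"]])
       (auto intro: acts_on_zero[OF M i] intro!: sum.cong)
  ultimately show ?thesis by (auto simp: vec_eq_iff Tr_factor_def)
qed

text \<open>Transposition reverses products and commutes with the partial trace, which reduces this
  to the left-hand version.\<close>

lemma Tr_factor_mult_right:
  fixes M N :: "('n::finite, 'l::finite) endT"
  assumes N: "acts_on S N" and i: "i \<notin> S"
  shows "Tr_factor i (M ** N) = Tr_factor i M ** N"
proof -
  have tr: "transpose (Tr_factor i A) = Tr_factor i (transpose A)" for A :: "('n, 'l) endT"
    by (simp add: transpose_def Tr_factor_def vec_eq_iff eq_commute)
  have "acts_on S (transpose N)"
    unfolding acts_on_def transpose_def vec_lambda_beta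
  proof (intro conjI allI impI)
    fix a b :: "'l \<Rightarrow> 'n" and k assume "k \<notin> S" "a k \<noteq> b k"
    then show "N $ b $ a = 0" by (intro acts_on_zero[OF N, of k]) auto
  next
    fix a b a' b' :: "'l \<Rightarrow> 'n"
    assume "\<forall>k. k \<in> S \<longrightarrow> a k = a' k \<and> b k = b' k" "\<forall>k. k \<notin> S \<longrightarrow> a k = b k \<and> a' k = b' k"
    then show "N $ b $ a = N $ b' $ a'" by (intro acts_on_cong[OF N]) auto
  qed
  from Tr_factor_mult_left[OF this i, of "transpose M"]
  have "transpose (Tr_factor i (M ** N)) = transpose (Tr_factor i M ** N)"
    by (simp add: matrix_transpose_mul tr)
  then show ?thesis by (metis transpose_transpose)
qed

section \<open>Operators on two factors\<close>

definition act1 :: "'n::finite end1 \<Rightarrow> 'n end2" where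
  "act1 Y = (\<chi> p q. if snd p = snd q then Y $ fst p $ fst q else 0)"

definition act2 :: "'n::finite end1 \<Rightarrow> 'n end2" where
  "act2 Y = (\<chi> p q. if fst p = fst q then Y $ snd p $ snd q else 0)"

section \<open>The flip symmetry and the contraction product\<close>

text \<open>In the notation of the paper, \<open>act1 Y\<close>, \<open>act2 Y\<close> and \<open>sw X\<close> are \<open>Y\<^sub>1\<close>, \<open>Y\<^sub>2\<close> and \<open>X\<^sub>2\<^sub>1\<close>.\<close>

definition sw :: "'n::finite end2 \<Rightarrow> 'n end2" where
  "sw X = (\<chi> p q. X $ prod.swap p $ prod.swap q)"

definition star :: "'n::finite end2 \<Rightarrow> 'n end2 \<Rightarrow> 'n end2" where
  "star X Y = (\<chi> p q. \<Sum>(b, g)\<in>UNIV. X $ (fst p, b) $ (fst q, g) * Y $ (g, snd p) $ (b, snd q))"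

text \<open>The reshuffling of indices which turns \<open>star\<close> into the matrix product.\<close>

definition flat :: "'n::finite end2 \<Rightarrow> 'n end2" where
  "flat X = (\<chi> p q. X $ (fst p, snd q) $ (snd p, fst q))"

lemma flat_inject: "flat X = flat Y \<longleftrightarrow> X = Y"
  by (auto simp: flat_def vec_eq_iff)

lemma flat_star: "flat (star X Y) = flat X ** flat Y"
  unfolding flat_def star_def matrix_matrix_mult_def vec_eq_iff vec_lambda_beta
  by (auto intro!: sum.reindex_bij_witness[where i = prod.swap and j = prod.swap])

lemma flat_flip: "flat flip = mat 1"
  by (auto simp: flat_def flip_def mat_def vec_eq_iff)

lemma star_assoc: "star (star X Y) Z = star X (star Y Z)"
  by (simp add: flat_star matrix_mul_assoc flip: flat_inject)

lemma star_flip [simp]: "star X flip = X" "star flip X = X"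
  by (simp_all add: flat_star flat_flip flip: flat_inject)

text \<open>Under \<open>flat\<close> these are one-sided inverses of a square matrix, hence
  two-sided. One of the two equations for a skew inverse is therefore enough.\<close>

lemma star_eq_flip_commute: "star X Y = flip \<longleftrightarrow> star Y X = flip"
  by (metis flat_flip flat_inject flat_star matrix_left_right_inverse)

lemma sw_sw [simp]: "sw (sw X) = X"
  by (simp add: sw_def vec_eq_iff)

lemma sw_inject: "sw X = sw Y \<longleftrightarrow> X = Y"
  by (metis sw_sw)

lemma sw_mult: "sw (X ** Y) = sw X ** sw Y"
  unfolding sw_def matrix_matrix_mult_def vec_eq_iff vec_lambda_beta
  by (intro allI sum.reindex_bij_witness[where i = prod.swap and j = prod.swap]) auto

lemma sw_act [simp]: "sw (act1 Y) = act2 Y" "sw (act2 Y) = act1 Y"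
  by (auto simp: sw_def act1_def act2_def vec_eq_iff)

lemma sw_one [simp]: "sw (mat 1) = mat 1"
  by (auto simp: sw_def mat_def vec_eq_iff prod_eq_iff)

lemma sw_flip [simp]: "sw flip = flip"
  by (auto simp: sw_def flip_def vec_eq_iff)

text \<open>\<open>sw\<close> preserves the ordinary product but reverses \<open>star\<close>.
  Together with the exchange of \<open>Tr1\<close> and \<open>Tr2\<close> this is the mirror
  symmetry between C and D.\<close>

lemma sw_star: "sw (star X Y) = star (sw Y) (sw X)"
  unfolding sw_def star_def vec_eq_iff vec_lambda_beta
  by (intro allI sum.reindex_bij_witness[where i = prod.swap and j = prod.swap]) auto

lemma Tr_sw [simp]: "Tr1 (sw X) = Tr2 X" "Tr2 (sw X) = Tr1 X"
  by (simp_all add: sw_def Tr1_def Tr2_def)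

lemma sum_UNIV_prod: "(\<Sum>p\<in>UNIV. f p) = (\<Sum>x\<in>UNIV. \<Sum>y\<in>UNIV. f (x, y))"
  by (simp add: sum.cartesian_product flip: UNIV_Times_UNIV)

lemma mult_act1: "(X ** act1 Y) $ p $ q = (\<Sum>x\<in>UNIV. X $ p $ (x, snd q) * Y $ x $ fst q)"
  by (simp add: matrix_matrix_mult_def act1_def sum_UNIV_prod if_distrib cong: if_cong)

lemma act1_mult: "(act1 Y ** X) $ p $ q = (\<Sum>x\<in>UNIV. Y $ fst p $ x * X $ (x, snd p) $ q)"
  by (simp add: matrix_matrix_mult_def act1_def sum_UNIV_prod if_distrib[where f = "\<lambda>x. x * _"] cong: if_cong)

lemma mult_act2: "(X ** act2 Y) $ p $ q = (\<Sum>x\<in>UNIV. X $ p $ (fst q, x) * Y $ x $ snd q)"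
  unfolding matrix_matrix_mult_def vec_lambda_beta sum_UNIV_prod
  by (subst sum.swap) (simp add: act2_def if_distrib cong: if_cong)

lemma act2_mult: "(act2 Y ** X) $ p $ q = (\<Sum>x\<in>UNIV. Y $ snd p $ x * X $ (fst p, x) $ q)"
  unfolding matrix_matrix_mult_def vec_lambda_beta sum_UNIV_prod
  by (subst sum.swap) (simp add: act2_def if_distrib[where f = "\<lambda>x. x * _"] cong: if_cong)

lemma act_mult: "act1 (Y ** Z) = act1 Y ** act1 Z" "act2 (Y ** Z) = act2 Y ** act2 Z"
  by (auto simp: vec_eq_iff act1_mult act2_mult) (auto simp: act1_def act2_def matrix_matrix_mult_def)

lemma act_one [simp]: "act1 (mat 1) = mat 1" "act2 (mat 1) = mat 1"
  by (auto simp: act1_def act2_def mat_def vec_eq_iff prod_eq_iff)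

lemma act1_act2: "act1 Y ** act2 Z = act2 Z ** act1 Y"
  by (simp add: vec_eq_iff act1_mult act2_mult) (simp add: act1_def act2_def if_distrib cong: if_cong)

lemma flip_mult_entry: "(flip ** X) $ p $ q = X $ prod.swap p $ q"
  unfolding matrix_matrix_mult_def vec_lambda_beta
  by (subst sum.remove[of _ "prod.swap p"]) (auto simp: flip_def prod_eq_iff intro!: sum.neutral split: if_splits)

lemma mult_flip_entry: "(X ** flip) $ p $ q = X $ p $ prod.swap q"
  unfolding matrix_matrix_mult_def vec_lambda_beta
  by (subst sum.remove[of _ "prod.swap q"]) (auto simp: flip_def prod_eq_iff intro!: sum.neutral split: if_splits)

lemma flip_mult: "flip ** X = sw X ** flip"
  by (simp add: vec_eq_iff flip_mult_entry mult_flip_entry sw_def)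

lemma star_act1_left: "star (act1 A ** X) Y = act1 A ** star X Y"
proof -
  have "star (act1 A ** X) Y $ p $ q = (act1 A ** star X Y) $ p $ q" for p q
    unfolding act1_mult star_def vec_lambda_beta split_beta fst_conv snd_conv sum_distrib_left sum_distrib_right
    by (subst sum.swap) (simp add: mult.assoc)
  then show ?thesis by (simp add: vec_eq_iff)
qed

lemma star_act1_right: "star (X ** act1 A) Y = star X Y ** act1 A"
proof -
  have "star (X ** act1 A) Y $ p $ q = (star X Y ** act1 A) $ p $ q" for p q
    unfolding mult_act1 star_def vec_lambda_beta split_beta fst_conv snd_conv sum_distrib_left sum_distrib_right
    by (subst sum.swap) (simp add: mult_ac)
  then show ?thesis by (simp add: vec_eq_iff)
qed

lemma star_act2_left: "star X (act2 A ** Y) = act2 A ** star X Y"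
  by (subst sw_inject[symmetric]) (simp add: sw_star sw_mult star_act1_left)

lemma star_act2_right: "star X (Y ** act2 A) = star X Y ** act2 A"
  by (subst sw_inject[symmetric]) (simp add: sw_star sw_mult star_act1_right)

text \<open>In X_12 A_2 Y_23 the operator A stands between both factors and may be counted with
  either.\<close>

lemma star_act_middle: "star (X ** act2 A) Y = star X (act1 A ** Y)"
proof -
  have "star (X ** act2 A) Y $ p $ q = star X (act1 A ** Y) $ p $ q" for p q
    unfolding mult_act2 act1_mult star_def vec_lambda_beta split_beta fst_conv snd_conv sum_UNIV_prod
      sum_distrib_left sum_distrib_right
    by (subst (2) sum.swap) (simp add: mult_ac)
  then show ?thesis by (simp add: vec_eq_iff)
qed

text \<open>Here A stands at the outer end of the contracted factor and is carried round by
  cyclicity of that trace.\<close>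

lemma star_act_middle': "star (act2 A ** X) Y = star X (Y ** act1 A)"
  by (subst sw_inject[symmetric]) (simp add: sw_star sw_mult star_act_middle)

lemma Tr1_act2: "Tr1 (act2 A ** X) = A ** Tr1 X" "Tr1 (X ** act2 A) = Tr1 X ** A"
proof -
  have "Tr1 (act2 A ** X) $ i $ j = (A ** Tr1 X) $ i $ j" for i j
    unfolding Tr1_def vec_lambda_beta act2_mult fst_conv snd_conv
    by (subst sum.swap) (simp add: matrix_matrix_mult_def sum_distrib_left)
  moreover have "Tr1 (X ** act2 A) $ i $ j = (Tr1 X ** A) $ i $ j" for i j
    unfolding Tr1_def vec_lambda_beta mult_act2 fst_conv snd_conv
    by (subst sum.swap) (simp add: matrix_matrix_mult_def sum_distrib_right)
  ultimately show "Tr1 (act2 A ** X) = A ** Tr1 X" "Tr1 (X ** act2 A) = Tr1 X ** A"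
    by (simp_all add: vec_eq_iff)
qed

lemma Tr2_act1: "Tr2 (act1 A ** X) = A ** Tr2 X" "Tr2 (X ** act1 A) = Tr2 X ** A"
  by (simp_all add: sw_mult Tr1_act2 flip: Tr_sw(1))

lemma Tr1_cyclic: "Tr1 (act1 A ** X) = Tr1 (X ** act1 A)"
proof -
  have "Tr1 (act1 A ** X) $ i $ j = Tr1 (X ** act1 A) $ i $ j" for i j
    unfolding Tr1_def vec_lambda_beta act1_mult mult_act1 fst_conv snd_conv
    by (subst sum.swap) (simp add: mult.commute)
  then show ?thesis by (simp add: vec_eq_iff)
qed

lemma Tr_flip [simp]: "Tr1 flip = (mat 1 :: 'n::finite end1)" "Tr2 flip = (mat 1 :: 'n end1)"
proof -
  have "Tr1 flip $ i $ j = (mat 1 :: 'n end1) $ i $ j" for i j :: 'n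
    by (subst Tr1_def) (auto simp: flip_def mat_def intro: trans[OF sum.remove[of _ i]])
  then show "Tr1 flip = (mat 1 :: 'n end1)" by (simp add: vec_eq_iff)
  then show "Tr2 flip = (mat 1 :: 'n end1)" by (metis Tr_sw(1) sw_flip)
qed

text \<open>The trace over factor 1 reaches only X, so X becomes its partial trace before factor 2
  is contracted.\<close>

lemma Tr1_star: "Tr1 (star X Y) = Tr1 (act1 (Tr1 X) ** Y)"
proof -
  have "Tr1 (star X Y) $ i $ j = Tr1 (act1 (Tr1 X) ** Y) $ i $ j" for i j
    unfolding Tr1_def star_def vec_lambda_beta act1_mult fst_conv snd_conv split_beta
    by (subst sum.swap) (simp add: sum_UNIV_prod sum_distrib_right)
  then show ?thesis by (simp add: vec_eq_iff)
qed

lemma Tr2_star: "Tr2 (star X Y) = Tr2 (X ** act2 (Tr2 Y))"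
proof -
  have "Tr2 (star X Y) = Tr1 (star (sw Y) (sw X))" by (simp flip: sw_star)
  also have "\<dots> = Tr1 (sw (X ** act2 (Tr2 Y)))" by (simp add: Tr1_star Tr1_cyclic sw_mult)
  finally show ?thesis by simp
qed

section \<open>From two factors to labelled factors\<close>

lemma on_factors_one [simp]: "m \<noteq> r \<Longrightarrow> on_factors m r (mat 1) = mat 1"
  by (auto simp: on_factors_def mat_def vec_eq_iff fun_eq_iff)

lemma on_factor_one [simp]: "on_factor m (mat 1) = mat 1"
  by (auto simp: on_factor_def mat_def vec_eq_iff fun_eq_iff)

lemma on_factors_act1: "m \<noteq> r \<Longrightarrow> on_factors m r (act1 Y) = on_factor m Y"
  by (auto simp: on_factors_def on_factor_def act1_def vec_eq_iff fun_eq_iff)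

lemma on_factors_act2: "m \<noteq> r \<Longrightarrow> on_factors m r (act2 Y) = on_factor r Y"
  by (auto simp: on_factors_def on_factor_def act2_def vec_eq_iff fun_eq_iff)

lemma on_factors_sw: "on_factors m r (sw X) = on_factors r m X"
  by (auto simp: on_factors_def sw_def vec_eq_iff fun_eq_iff)

lemma on_factors_mult:
  assumes "m \<noteq> r" shows "on_factors m r (X ** Y) = on_factors m r X ** on_factors m r Y"
proof -
  have "(on_factors m r X ** on_factors m r Y) $ a $ b = on_factors m r (X ** Y) $ a $ b" for a b
    unfolding matrix_matrix_mult_def vec_lambda_beta
    by (subst sum_fun_upd2[OF assms, where a = a])
       (use assms in \<open>auto simp: on_factors_def matrix_matrix_mult_def intro!: sum.neutral\<close>)
  then show ?thesis by (simp add: vec_eq_iff)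
qed

lemma on_factor_mult: "on_factor m (X ** Y) = on_factor m X ** on_factor m Y"
proof -
  have "(on_factor m X ** on_factor m Y) $ a $ b = on_factor m (X ** Y) $ a $ b" for a b
    unfolding matrix_matrix_mult_def vec_lambda_beta
    by (subst sum_fun_upd1[where a = a and m = m])
       (auto simp: on_factor_def matrix_matrix_mult_def intro!: sum.neutral)
  then show ?thesis by (simp add: vec_eq_iff)
qed

lemma on_factor_inject: "on_factor m X = on_factor m Y \<longleftrightarrow> X = Y"
proof
  assume eq: "on_factor m X = on_factor m Y"
  have "X $ i $ j = Y $ i $ j" for i j
    using arg_cong[OF eq, of "\<lambda>M. M $ (\<lambda>_. i) $ (\<lambda>_. i)(m := j)"] by (simp add: on_factor_def)
  then show "X = Y" by (simp add: vec_eq_iff)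
qed simp

lemma Tr_factor_second: "m \<noteq> r \<Longrightarrow> Tr_factor r (on_factors m r X) = on_factor m (Tr2 X)"
  by (auto simp: Tr_factor_def on_factors_def on_factor_def Tr2_def vec_eq_iff intro!: sum.neutral)

lemma Tr_factor_first: "m \<noteq> r \<Longrightarrow> Tr_factor m (on_factors m r X) = on_factor r (Tr1 X)"
  using Tr_factor_second[of r m "sw X"] by (simp add: on_factors_sw)

lemma flip_factors_mult:
  assumes "m \<noteq> r" shows "(on_factors m r flip ** M) $ a $ b = M $ (a \<circ> Transposition.transpose m r) $ b"
proof -
  have "(on_factors m r flip ** M) $ a $ b =
    (\<Sum>p\<in>UNIV. (if (a m, a r) = (snd p, fst p) then 1 else 0) * M $ (a(m := fst p, r := snd p)) $ b)"
    unfolding matrix_matrix_mult_def vec_lambda_beta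
    by (subst sum_fun_upd2[OF assms, where a = a]) (use assms in \<open>auto simp: on_factors_def flip_def\<close>)
  also have "\<dots> = M $ (a(m := a r, r := a m)) $ b"
    by (subst sum.remove[of _ "(a r, a m)"]) (auto intro!: sum.neutral split: if_splits)
  also have "a(m := a r, r := a m) = a \<circ> Transposition.transpose m r"
    using assms by (auto simp: Transposition.transpose_def fun_eq_iff)
  finally show ?thesis .
qed

lemma mult_flip_factors:
  assumes "m \<noteq> r" shows "(M ** on_factors m r flip) $ a $ b = M $ a $ (b \<circ> Transposition.transpose m r)"
proof -
  have "(M ** on_factors m r flip) $ a $ b =
    (\<Sum>p\<in>UNIV. M $ a $ (b(m := fst p, r := snd p)) * (if p = (b r, b m) then 1 else 0))"
    unfolding matrix_matrix_mult_def vec_lambda_beta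
    by (subst sum_fun_upd2[OF assms, where a = b]) (use assms in \<open>auto simp: on_factors_def flip_def\<close>)
  also have "\<dots> = M $ a $ (b(m := b r, r := b m))"
    by (subst sum.remove[of _ "(b r, b m)"]) (auto intro!: sum.neutral split: if_splits)
  also have "b(m := b r, r := b m) = b \<circ> Transposition.transpose m r"
    using assms by (auto simp: Transposition.transpose_def fun_eq_iff)
  finally show ?thesis .
qed

lemma flip_on_factors:
  assumes "m \<noteq> r" "s \<noteq> t"
  shows "on_factors m r flip ** on_factors s t X =
    on_factors (Transposition.transpose m r s) (Transposition.transpose m r t) X ** on_factors m r flip"
proof -
  have "(\<forall>k. k \<noteq> s \<and> k \<noteq> t \<longrightarrow> a (Transposition.transpose m r k) = b k) \<longleftrightarrow>
    (\<forall>k. k \<noteq> Transposition.transpose m r s \<and> k \<noteq> Transposition.transpose m r t \<longrightarrow>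
       a k = b (Transposition.transpose m r k))" for a b :: "'a \<Rightarrow> 'b"
    by (metis transpose_involutory)
  then show ?thesis
    by (simp add: vec_eq_iff flip_factors_mult mult_flip_factors assms) (auto simp: on_factors_def)
qed

lemma flip_on_factor:
  assumes "m \<noteq> r"
  shows "on_factors m r flip ** on_factor s X =
    on_factor (Transposition.transpose m r s) X ** on_factors m r flip"
proof -
  have "(\<forall>k. k \<noteq> s \<longrightarrow> a (Transposition.transpose m r k) = b k) \<longleftrightarrow>
    (\<forall>k. k \<noteq> Transposition.transpose m r s \<longrightarrow>
       a k = b (Transposition.transpose m r k))" for a b :: "'a \<Rightarrow> 'b"
    by (metis transpose_involutory)
  then show ?thesis
    by (simp add: vec_eq_iff flip_factors_mult mult_flip_factors assms) (auto simp: on_factor_def)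
qed

text \<open>Identifies \<open>star\<close> with the contraction in any tensor power and for any
  three labels, so that skew invertibility can be used wherever an auxiliary strand is
  inserted.\<close>

lemma Tr_star:
  assumes "i \<noteq> j" "j \<noteq> k" "i \<noteq> k"
  shows "Tr_factor j (on_factors i j X ** on_factors j k Y) = on_factors i k (star X Y)"
proof -
  have "(on_factors i j X ** on_factors j k Y) $ a $ b =
     (\<Sum>g\<in>UNIV. if \<forall>l. l \<noteq> i \<and> l \<noteq> j \<and> l \<noteq> k \<longrightarrow> a l = b l
        then X $ (a i, a j) $ (b i, g) * Y $ (g, a k) $ (b j, b k) else 0)" for a b
  proof -
    have "(on_factors i j X ** on_factors j k Y) $ a $ b =
     (\<Sum>p\<in>UNIV. X $ (a i, a j) $ p * (if fst p = b i \<and> (\<forall>l. l \<noteq> i \<and> l \<noteq> j \<and> l \<noteq> k \<longrightarrow> a l = b l)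
        then Y $ (snd p, a k) $ (b j, b k) else 0))"
      unfolding matrix_matrix_mult_def vec_lambda_beta
      by (subst sum_fun_upd2[OF assms(1), where a = a])
         (use assms in \<open>auto simp: on_factors_def intro!: sum.cong\<close>)
    also have "\<dots> = (\<Sum>g\<in>UNIV. \<Sum>x\<in>UNIV. X $ (a i, a j) $ (x, g) *
       (if x = b i \<and> (\<forall>l. l \<noteq> i \<and> l \<noteq> j \<and> l \<noteq> k \<longrightarrow> a l = b l) then Y $ (g, a k) $ (b j, b k) else 0))"
      unfolding sum_UNIV_prod fst_conv snd_conv by (rule sum.swap)
    finally have *: "(on_factors i j X ** on_factors j k Y) $ a $ b = (\<Sum>g\<in>UNIV. \<Sum>x\<in>UNIV. X $ (a i, a j) $ (x, g) *
       (if x = b i \<and> (\<forall>l. l \<noteq> i \<and> l \<noteq> j \<and> l \<noteq> k \<longrightarrow> a l = b l) then Y $ (g, a k) $ (b j, b k) else 0))" .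
    show ?thesis
    proof (cases "\<forall>l. l \<noteq> i \<and> l \<noteq> j \<and> l \<noteq> k \<longrightarrow> a l = b l")
      case True
      have "(\<Sum>x\<in>UNIV. X $ (a i, a j) $ (x, g) * (if x = b i \<and> (\<forall>l. l \<noteq> i \<and> l \<noteq> j \<and> l \<noteq> k \<longrightarrow> a l = b l)
         then Y $ (g, a k) $ (b j, b k) else 0)) = X $ (a i, a j) $ (b i, g) * Y $ (g, a k) $ (b j, b k)" for g
        by (subst sum.remove[of _ "b i"]) (auto simp: True intro!: sum.neutral)
      then show ?thesis unfolding * if_P[OF True] by (intro sum.cong refl)
    next
      case False
      show ?thesis unfolding * if_not_P[OF False] using False by (auto intro!: sum.neutral)
    qed
  qed
  note e = this
  have "Tr_factor j (on_factors i j X ** on_factors j k Y) $ a $ b = on_factors i k (star X Y) $ a $ b" for a b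
  proof (cases "\<forall>l. l \<noteq> i \<and> l \<noteq> k \<longrightarrow> a l = b l")
    case True
    then show ?thesis using assms
      by (simp add: Tr_factor_def e) (simp add: on_factors_def star_def sum_UNIV_prod)
  next
    case False
    then have "on_factors i k (star X Y) $ a $ b = 0" by (auto simp: on_factors_def)
    moreover have "Tr_factor j (on_factors i j X ** on_factors j k Y) $ a $ b = 0"
      using False assms unfolding Tr_factor_def vec_lambda_beta e by (auto intro!: sum.neutral)
    ultimately show ?thesis by simp
  qed
  then show ?thesis unfolding vec_eq_iff by blast
qed

section \<open>Braid relations and skew inverses\<close>

abbreviation (input) on_factors_syntax ("_\<langle>_,_\<rangle>" [1000, 0, 0] 1000) where
  "X\<langle>m,r\<rangle> \<equiv> on_factors m r X"

abbreviation (input) on_factor_syntax ("_\<langle>_\<rangle>" [1000, 0] 1000) where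
  "Y\<langle>m\<rangle> \<equiv> on_factor m Y"

section \<open>Relabelling of factors\<close>

text \<open>Transports an operator along a relabelling, by the identity outside the range. Along an
  injection this is an injective homomorphism, so a braid relation on the labels of type
  \<open>3\<close> is equivalent to the same relation on any three distinct labels.\<close>

definition emb :: "('k \<Rightarrow> 'l) \<Rightarrow> ('n::finite, 'k::finite) endT \<Rightarrow> ('n, 'l::finite) endT" where
  "emb f M = (\<chi> a b. if \<forall>x. x \<notin> range f \<longrightarrow> a x = b x then M $ (a \<circ> f) $ (b \<circ> f) else 0)"

lemma emb_mult:
  assumes "inj f" shows "emb f (M ** N) = emb f M ** emb f N"
proof -
  have "(emb f M ** emb f N) $ a $ b = emb f (M ** N) $ a $ b" for a b
  proof -
    let ?A = "{c. \<forall>x. x \<notin> range f \<longrightarrow> a x = c x}"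
    have "(emb f M ** emb f N) $ a $ b = (\<Sum>c\<in>?A. emb f M $ a $ c * emb f N $ c $ b)"
      unfolding matrix_matrix_mult_def vec_lambda_beta
      by (rule sum.mono_neutral_right) (auto simp: emb_def)
    also have "\<dots> = (\<Sum>c\<in>?A. M $ (a \<circ> f) $ (c \<circ> f) * (if \<forall>x. x \<notin> range f \<longrightarrow> a x = b x then N $ (c \<circ> f) $ (b \<circ> f) else 0))"
      by (rule sum.cong) (auto simp: emb_def)
    also have "\<dots> = (\<Sum>d\<in>UNIV. M $ (a \<circ> f) $ d * (if \<forall>x. x \<notin> range f \<longrightarrow> a x = b x then N $ d $ (b \<circ> f) else 0))"
      by (rule sum.reindex_bij_witness[where j = "\<lambda>c. c \<circ> f" and i = "\<lambda>d x. if x \<in> range f then d (inv f x) else a x"])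
         (use assms in \<open>auto simp: fun_eq_iff\<close>)
    also have "\<dots> = emb f (M ** N) $ a $ b"
    proof (cases "\<forall>x. x \<notin> range f \<longrightarrow> a x = b x")
      case True
      show ?thesis by (simp only: emb_def matrix_matrix_mult_def vec_lambda_beta if_P[OF True])
    next
      case False
      show ?thesis by (simp only: emb_def vec_lambda_beta if_not_P[OF False] mult_zero_right sum.neutral_const)
    qed
    finally show ?thesis .
  qed
  then show ?thesis by (simp add: vec_eq_iff)
qed

lemma emb_inject:
  assumes "inj f" shows "emb f M = emb f N \<longleftrightarrow> M = N"
proof
  assume eq: "emb f M = emb f N"
  have "M $ a $ b = N $ a $ b" for a b
  proof -
    define ex where "ex d x = (if x \<in> range f then d (inv f x) else undefined)" for d :: "'a \<Rightarrow> 'c" and x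
    have "ex d \<circ> f = d" for d using assms by (auto simp: ex_def fun_eq_iff)
    moreover have "\<forall>x. x \<notin> range f \<longrightarrow> ex a x = ex b x" by (simp add: ex_def)
    ultimately show ?thesis using arg_cong[OF eq, of "\<lambda>M. M $ ex a $ ex b"] by (simp add: emb_def)
  qed
  then show "M = N" by (simp add: vec_eq_iff)
qed simp

lemma emb_on_factors:
  assumes "inj f" shows "emb f (X\<langle>m,r\<rangle>) = X\<langle>f m,f r\<rangle>"
proof -
  have "(\<forall>x. x \<notin> range f \<longrightarrow> a x = b x) \<and> (\<forall>k. k \<noteq> m \<and> k \<noteq> r \<longrightarrow> a (f k) = b (f k)) \<longleftrightarrow>
     (\<forall>x. x \<noteq> f m \<and> x \<noteq> f r \<longrightarrow> a x = b x)" (is "?A \<and> ?B \<longleftrightarrow> ?C") for a b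
  proof
    assume *: "?A \<and> ?B"
    show ?C
    proof (intro allI impI)
      fix x assume x: "x \<noteq> f m \<and> x \<noteq> f r"
      show "a x = b x"
      proof (cases "x \<in> range f")
        case True
        then obtain k where "x = f k" by blast
        then show ?thesis using * x by auto
      qed (use * in blast)
    qed
  next
    assume ?C
    then show "?A \<and> ?B" using injD[OF assms] by blast
  qed
  note iff = this
  have *: "(if \<forall>x. x \<notin> range f \<longrightarrow> a x = b x
      then if \<forall>k. k \<noteq> m \<and> k \<noteq> r \<longrightarrow> a (f k) = b (f k) then z else 0 else 0) =
     (if \<forall>x. x \<noteq> f m \<and> x \<noteq> f r \<longrightarrow> a x = b x then z else 0)" for a b and z :: complex
    unfolding iff[symmetric] by auto
  show ?thesis unfolding vec_eq_iff emb_def on_factors_def vec_lambda_beta o_apply * by simp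
qed

text \<open>The second relation of a compatible pair amounts to the first one with \<open>F\<close> replaced by its
  inverse, see \<open>braid_rel_inverse_iff\<close> below.\<close>

definition braid_rel :: "'n::finite end2 \<Rightarrow> 'n end2 \<Rightarrow> bool" where
  "braid_rel R F \<longleftrightarrow>
     (R\<langle>1,2\<rangle> ** F\<langle>2,3\<rangle> ** F\<langle>1,2\<rangle> :: ('n, 3) endT) = F\<langle>2,3\<rangle> ** F\<langle>1,2\<rangle> ** R\<langle>2,3\<rangle>"

lemma braid_rel_iff:
  fixes i j k :: "'l::finite"
  assumes "distinct [i, j, k]"
  shows "braid_rel R F \<longleftrightarrow> R\<langle>i,j\<rangle> ** F\<langle>j,k\<rangle> ** F\<langle>i,j\<rangle> = F\<langle>j,k\<rangle> ** F\<langle>i,j\<rangle> ** R\<langle>j,k\<rangle>"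
proof -
  define f where "f = (\<lambda>x::3. if x = 1 then i else if x = 2 then j else k)"
  have f: "inj f" using assms by (auto simp: inj_def f_def forall_3)
  have [simp]: "f 1 = i" "f 2 = j" "f 3 = k" by (simp_all add: f_def)
  show ?thesis
    unfolding braid_rel_def emb_inject[OF f, symmetric]
    by (simp add: emb_mult emb_on_factors f)
qed

section \<open>Rewriting rules for independent factors and flips\<close>

abbreviation (input) indep :: "'l \<Rightarrow> ('n::finite, 'l::finite) endT \<Rightarrow> bool" where
  "indep i M \<equiv> acts_on (- {i}) M"

lemma indep_mult [simp]: "indep i M \<Longrightarrow> indep i N \<Longrightarrow> indep i (M ** N)"
  by (rule acts_on_mult_same)

lemma indep_on_factors [simp]: "i \<noteq> m \<Longrightarrow> i \<noteq> r \<Longrightarrow> indep i (X\<langle>m,r\<rangle>)"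
  by (rule acts_on_mono[OF acts_on_factors]) auto

lemma indep_on_factor [simp]: "i \<noteq> m \<Longrightarrow> indep i (X\<langle>m\<rangle>)"
  by (rule acts_on_mono[OF acts_on_factor]) auto

lemma Tr_left: "indep i M \<Longrightarrow> Tr_factor i (M ** N) = M ** Tr_factor i N"
  by (rule Tr_factor_mult_left) auto

lemma Tr_right: "indep i N \<Longrightarrow> Tr_factor i (M ** N) = Tr_factor i M ** N"
  by (rule Tr_factor_mult_right) auto

lemma commute22: "i \<noteq> k \<Longrightarrow> i \<noteq> l \<Longrightarrow> j \<noteq> k \<Longrightarrow> j \<noteq> l \<Longrightarrow> X\<langle>i,j\<rangle> ** Y\<langle>k,l\<rangle> = Y\<langle>k,l\<rangle> ** X\<langle>i,j\<rangle>"
  by (rule mult_commute_disjoint[OF acts_on_factors acts_on_factors]) auto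

lemma commute21: "i \<noteq> k \<Longrightarrow> j \<noteq> k \<Longrightarrow> X\<langle>i,j\<rangle> ** Y\<langle>k\<rangle> = Y\<langle>k\<rangle> ** X\<langle>i,j\<rangle>"
  by (rule mult_commute_disjoint[OF acts_on_factors acts_on_factor]) auto

lemma commute11: "i \<noteq> k \<Longrightarrow> X\<langle>i\<rangle> ** Y\<langle>k\<rangle> = Y\<langle>k\<rangle> ** X\<langle>i\<rangle>"
  by (rule mult_commute_disjoint[OF acts_on_factor acts_on_factor]) auto

lemma mult_left_commuteI: "A ** B = B ** A \<Longrightarrow> A ** (B ** M) = B ** (A ** M)"
  by (simp add: matrix_mul_assoc)

lemmas commutes = commute22 commute21 commute11
  mult_left_commuteI[OF commute22] mult_left_commuteI[OF commute21] mult_left_commuteI[OF commute11]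

lemmas reassoc = matrix_mul_assoc[symmetric]

lemma ext2: "A ** B = M \<Longrightarrow> A ** (B ** N) = M ** N"
  by (simp add: matrix_mul_assoc)

text \<open>Oriented so that rewriting transports a flip to the right end of a product.\<close>

lemma flip_moves:
  assumes "s \<noteq> m" "s \<noteq> r" "m \<noteq> r"
  shows "flip\<langle>m,r\<rangle> ** X\<langle>m,s\<rangle> = X\<langle>r,s\<rangle> ** flip\<langle>m,r\<rangle>"
    "flip\<langle>m,r\<rangle> ** X\<langle>r,s\<rangle> = X\<langle>m,s\<rangle> ** flip\<langle>m,r\<rangle>"
    "flip\<langle>m,r\<rangle> ** X\<langle>s,m\<rangle> = X\<langle>s,r\<rangle> ** flip\<langle>m,r\<rangle>"
    "flip\<langle>m,r\<rangle> ** X\<langle>s,r\<rangle> = X\<langle>s,m\<rangle> ** flip\<langle>m,r\<rangle>"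
  using assms by (simp_all add: flip_on_factors)

lemma flip_moves2:
  assumes "m \<noteq> r"
  shows "flip\<langle>m,r\<rangle> ** X\<langle>m,r\<rangle> = X\<langle>r,m\<rangle> ** flip\<langle>m,r\<rangle>"
    "flip\<langle>m,r\<rangle> ** X\<langle>r,m\<rangle> = X\<langle>m,r\<rangle> ** flip\<langle>m,r\<rangle>"
    "flip\<langle>m,r\<rangle> ** Y\<langle>m\<rangle> = Y\<langle>r\<rangle> ** flip\<langle>m,r\<rangle>"
    "flip\<langle>m,r\<rangle> ** Y\<langle>r\<rangle> = Y\<langle>m\<rangle> ** flip\<langle>m,r\<rangle>"
  using assms by (simp_all add: flip_on_factors flip_on_factor)

lemma flip_passes:
  "m \<noteq> k \<Longrightarrow> r \<noteq> k \<Longrightarrow> m \<noteq> l \<Longrightarrow> r \<noteq> l \<Longrightarrow> flip\<langle>m,r\<rangle> ** X\<langle>k,l\<rangle> = X\<langle>k,l\<rangle> ** flip\<langle>m,r\<rangle>"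
  "m \<noteq> k \<Longrightarrow> r \<noteq> k \<Longrightarrow> flip\<langle>m,r\<rangle> ** Y\<langle>k\<rangle> = Y\<langle>k\<rangle> ** flip\<langle>m,r\<rangle>"
  by (rule commute22 commute21; simp)+

lemmas flips = flip_moves flip_moves2 flip_passes
  flip_moves[THEN ext2] flip_moves2[THEN ext2] flip_passes[THEN ext2]

lemma flip_flip: "flip ** flip = mat 1"
  by (simp add: vec_eq_iff flip_mult_entry) (auto simp: flip_def mat_def prod_eq_iff)

lemma flip_square: "m \<noteq> r \<Longrightarrow> flip\<langle>m,r\<rangle> ** flip\<langle>m,r\<rangle> = mat 1"
  by (simp add: flip_flip flip: on_factors_mult)

lemma flip_sym: "flip\<langle>m,r\<rangle> = flip\<langle>r,m\<rangle>"
  by (metis on_factors_sw sw_flip)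

lemma Tr_flip_factors: "m \<noteq> r \<Longrightarrow> Tr_factor m (flip\<langle>m,r\<rangle>) = mat 1" "m \<noteq> r \<Longrightarrow> Tr_factor r (flip\<langle>m,r\<rangle>) = mat 1"
  by (simp_all add: Tr_factor_first Tr_factor_second)

lemma distinct3:
  assumes "distinct [a, b, c]"
  shows "a \<noteq> b" "a \<noteq> c" "b \<noteq> a" "b \<noteq> c" "c \<noteq> a" "c \<noteq> b"
  using assms by auto

lemma distinct4:
  assumes "distinct [a, b, c, d]"
  shows "a \<noteq> b" "a \<noteq> c" "a \<noteq> d" "b \<noteq> a" "b \<noteq> c" "b \<noteq> d" "c \<noteq> a" "c \<noteq> b" "c \<noteq> d" "d \<noteq> a" "d \<noteq> b" "d \<noteq> c"
  using assms by auto

lemma distinct7: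
  assumes "distinct [a, b, c, d, e, f, g]"
  shows "a \<noteq> b" "a \<noteq> c" "a \<noteq> d" "a \<noteq> e" "a \<noteq> f" "a \<noteq> g" "b \<noteq> a" "b \<noteq> c" "b \<noteq> d" "b \<noteq> e" "b \<noteq> f" "b \<noteq> g" "c \<noteq> a" "c \<noteq> b" "c \<noteq> d" "c \<noteq> e" "c \<noteq> f" "c \<noteq> g" "d \<noteq> a" "d \<noteq> b" "d \<noteq> c" "d \<noteq> e" "d \<noteq> f" "d \<noteq> g" "e \<noteq> a" "e \<noteq> b" "e \<noteq> c" "e \<noteq> d" "e \<noteq> f" "e \<noteq> g" "f \<noteq> a" "f \<noteq> b" "f \<noteq> c" "f \<noteq> d" "f \<noteq> e" "f \<noteq> g" "g \<noteq> a" "g \<noteq> b" "g \<noteq> c" "g \<noteq> d" "g \<noteq> e" "g \<noteq> f"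
  using assms by auto

section \<open>Braid relations with an invertible operator\<close>

text \<open>The inverse is a parameter of its own, so that results can be reinterpreted with F and
  Fi exchanged or with both replaced by their \<open>sw\<close> images.\<close>

locale invertible_pair =
  fixes F Fi :: "'n::finite end2"
  assumes F_Fi: "F ** Fi = mat 1" and Fi_F: "Fi ** F = mat 1"
begin

lemma cancel [simp]: "i \<noteq> j \<Longrightarrow> F\<langle>i,j\<rangle> ** Fi\<langle>i,j\<rangle> = mat 1" "i \<noteq> j \<Longrightarrow> Fi\<langle>i,j\<rangle> ** F\<langle>i,j\<rangle> = mat 1"
  by (simp_all add: F_Fi Fi_F flip: on_factors_mult)

lemma cancel' [simp]: "i \<noteq> j \<Longrightarrow> F\<langle>i,j\<rangle> ** (Fi\<langle>i,j\<rangle> ** M) = M" "i \<noteq> j \<Longrightarrow> Fi\<langle>i,j\<rangle> ** (F\<langle>i,j\<rangle> ** M) = M"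
  by (simp_all add: matrix_mul_assoc)

lemma invertible_pair_sw: "invertible_pair (sw F) (sw Fi)"
  by unfold_locales (simp_all add: F_Fi Fi_F flip: sw_mult)

lemma invertible_pair_commute: "invertible_pair Fi F"
  by unfold_locales (simp_all add: F_Fi Fi_F)

lemma braid_rel_conj:
  assumes "braid_rel X F" "distinct [i, j, k]"
  shows "Fi\<langle>j,k\<rangle> ** (X\<langle>i,j\<rangle> ** F\<langle>j,k\<rangle>) = F\<langle>i,j\<rangle> ** (X\<langle>j,k\<rangle> ** Fi\<langle>i,j\<rangle>)"
proof -
  have r: "X\<langle>i,j\<rangle> ** F\<langle>j,k\<rangle> ** F\<langle>i,j\<rangle> = F\<langle>j,k\<rangle> ** F\<langle>i,j\<rangle> ** X\<langle>j,k\<rangle>"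
    using assms braid_rel_iff by blast
  have "Fi\<langle>j,k\<rangle> ** (X\<langle>i,j\<rangle> ** F\<langle>j,k\<rangle> ** F\<langle>i,j\<rangle>) ** Fi\<langle>i,j\<rangle> = F\<langle>i,j\<rangle> ** (X\<langle>j,k\<rangle> ** Fi\<langle>i,j\<rangle>)"
    unfolding r using assms(2) by (simp add: reassoc)
  then show ?thesis using assms(2) by (simp add: reassoc)
qed

text \<open>Multiply by Fi_23 Fi_12 on both sides; this can be undone, hence the
  equivalence.\<close>

lemma braid_rel_inverse_iff:
  "braid_rel X Fi \<longleftrightarrow> (X\<langle>2,3\<rangle> ** F\<langle>1,2\<rangle> ** F\<langle>2,3\<rangle> :: ('n, 3) endT) = F\<langle>1,2\<rangle> ** F\<langle>2,3\<rangle> ** X\<langle>1,2\<rangle>"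
  (is "_ \<longleftrightarrow> ?A = ?B")
proof -
  have "?A = ?B \<longleftrightarrow> Fi\<langle>2,3\<rangle> ** Fi\<langle>1,2\<rangle> ** ?A ** Fi\<langle>2,3\<rangle> ** Fi\<langle>1,2\<rangle> = Fi\<langle>2,3\<rangle> ** Fi\<langle>1,2\<rangle> ** ?B ** Fi\<langle>2,3\<rangle> ** Fi\<langle>1,2\<rangle>"
  proof
    assume *: "Fi\<langle>2,3\<rangle> ** Fi\<langle>1,2\<rangle> ** ?A ** Fi\<langle>2,3\<rangle> ** Fi\<langle>1,2\<rangle> = Fi\<langle>2,3\<rangle> ** Fi\<langle>1,2\<rangle> ** ?B ** Fi\<langle>2,3\<rangle> ** Fi\<langle>1,2\<rangle>"
    have "F\<langle>1,2\<rangle> ** F\<langle>2,3\<rangle> ** (Fi\<langle>2,3\<rangle> ** Fi\<langle>1,2\<rangle> ** Z ** Fi\<langle>2,3\<rangle> ** Fi\<langle>1,2\<rangle>) ** F\<langle>1,2\<rangle> ** F\<langle>2,3\<rangle> = Z" for Z :: "('n, 3) endT"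
      by (simp add: reassoc)
    then show "?A = ?B" using * by metis
  qed simp
  also have "\<dots> \<longleftrightarrow> braid_rel X Fi"
    unfolding braid_rel_def by (simp add: reassoc eq_commute)
  finally show ?thesis by simp
qed

text \<open>Read the relation with Fi on the strands 3, 2, 1 and clear the inverses. Reversal of the
  factors thus exchanges the two compatibility relations.\<close>

lemma braid_rel_sw:
  assumes "braid_rel X Fi" shows "braid_rel (sw X) (sw F)"
proof -
  have d: "distinct [3::3, 2, 1]" by simp
  interpret I: invertible_pair Fi F by (rule invertible_pair_commute)
  have "F\<langle>2,1\<rangle> ** (X\<langle>3,2\<rangle> ** Fi\<langle>2,1\<rangle>) = Fi\<langle>3,2\<rangle> ** (X\<langle>2,1\<rangle> ** (F\<langle>3,2\<rangle> :: ('n, 3) endT))"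
    by (rule I.braid_rel_conj[OF assms d])
  then have "F\<langle>3,2\<rangle> ** (F\<langle>2,1\<rangle> ** (X\<langle>3,2\<rangle> ** Fi\<langle>2,1\<rangle>)) ** F\<langle>2,1\<rangle> = F\<langle>3,2\<rangle> ** (Fi\<langle>3,2\<rangle> ** (X\<langle>2,1\<rangle> ** (F\<langle>3,2\<rangle> :: ('n, 3) endT))) ** F\<langle>2,1\<rangle>"
    by simp
  then show ?thesis unfolding braid_rel_def on_factors_sw by (simp add: reassoc)
qed

end

locale skew_pair =
  fixes X \<Phi> :: "'n::finite end2"
  assumes star_X: "star X \<Phi> = flip" and star_\<Phi>: "star \<Phi> X = flip"
begin

lemma Tr_X: "distinct [i, j, k] \<Longrightarrow> Tr_factor j (X\<langle>i,j\<rangle> ** \<Phi>\<langle>j,k\<rangle>) = flip\<langle>i,k\<rangle>"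
  by (simp add: Tr_star star_X)

lemma Tr_\<Phi>: "distinct [i, j, k] \<Longrightarrow> Tr_factor j (\<Phi>\<langle>i,j\<rangle> ** X\<langle>j,k\<rangle>) = flip\<langle>i,k\<rangle>"
  by (simp add: Tr_star star_\<Phi>)

text \<open>The second partial trace of \<open>star X \<Phi> = flip\<close>. It is what permits a
  closed strand to be inserted or removed.\<close>

lemma Tr2_X: "Tr2 (X ** act2 (Tr2 \<Phi>)) = mat 1"
  by (simp add: star_X flip: Tr2_star)

lemma Tr1_X: "Tr1 (act1 (Tr1 \<Phi>) ** X) = mat 1"
  by (simp add: star_\<Phi> flip: Tr1_star)

lemma Tr_X_D: "i \<noteq> j \<Longrightarrow> Tr_factor j (X\<langle>i,j\<rangle> ** (Tr2 \<Phi>)\<langle>j\<rangle>) = mat 1"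
  by (simp add: Tr_factor_second Tr2_X flip: on_factors_mult on_factors_act2[of i j])

lemma Tr_C_X: "i \<noteq> j \<Longrightarrow> Tr_factor i ((Tr1 \<Phi>)\<langle>i\<rangle> ** X\<langle>i,j\<rangle>) = mat 1"
  by (simp add: Tr_factor_first Tr1_X flip: on_factors_mult on_factors_act1[of i j])

lemma skew_pair_sw: "skew_pair (sw X) (sw \<Phi>)"
  by unfold_locales (simp_all add: star_X star_\<Phi> flip: sw_star)

end

text \<open>Contract the braid relation \<open>F\<^sub>j\<^sub>k\<^sup>-\<^sup>1 X\<^sub>i\<^sub>j F\<^sub>j\<^sub>k = F\<^sub>i\<^sub>j X\<^sub>j\<^sub>k F\<^sub>i\<^sub>j\<^sup>-\<^sup>1\<close> with
  \<open>\<Phi>\<^sub>h\<^sub>i\<close> over the factor \<open>i\<close> and with \<open>(Tr2 \<Phi>)\<^sub>k\<close> over the factor \<open>k\<close>.\<close>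

lemma (in invertible_pair) trace_exchange:
  fixes h j k :: "'l::finite"
  assumes X: "skew_pair X \<Phi>" "braid_rel X F" and d: "distinct [h, i, j, k]"
  shows "Tr_factor k (Fi\<langle>h,k\<rangle> ** F\<langle>j,k\<rangle> ** (Tr2 \<Phi>)\<langle>k\<rangle>) = flip\<langle>h,j\<rangle> ** (Tr2 \<Phi>)\<langle>h\<rangle>"
proof -
  interpret skew_pair X \<Phi> by fact
  let ?D = "Tr2 \<Phi>"
  note d = distinct4[OF d]
  have r: "Fi\<langle>j,k\<rangle> ** (X\<langle>i,j\<rangle> ** F\<langle>j,k\<rangle>) = F\<langle>i,j\<rangle> ** (X\<langle>j,k\<rangle> ** Fi\<langle>i,j\<rangle>)"
    by (rule braid_rel_conj[OF X(2)]) (use d in simp)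
  \<comment> \<open>The flip is adjoined in order to be written as Tr_i \<Phi>_hi X_ij, which places
    X_ij between Fi_jk and F_jk.\<close>
  have "flip\<langle>h,j\<rangle> ** Tr_factor k (Fi\<langle>h,k\<rangle> ** F\<langle>j,k\<rangle> ** ?D\<langle>k\<rangle>) = Tr_factor k (flip\<langle>h,j\<rangle> ** (Fi\<langle>h,k\<rangle> ** F\<langle>j,k\<rangle> ** ?D\<langle>k\<rangle>))"
    using d by (simp add: Tr_left)
  also have "\<dots> = Tr_factor k (Fi\<langle>j,k\<rangle> ** flip\<langle>h,j\<rangle> ** (F\<langle>j,k\<rangle> ** ?D\<langle>k\<rangle>))"
    using d by (simp add: reassoc flips)
  also have "\<dots> = Tr_factor k (Tr_factor i (Fi\<langle>j,k\<rangle> ** (\<Phi>\<langle>h,i\<rangle> ** X\<langle>i,j\<rangle>) ** (F\<langle>j,k\<rangle> ** ?D\<langle>k\<rangle>)))"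
    using d by (simp add: Tr_left Tr_right Tr_\<Phi>)
  also have "Fi\<langle>j,k\<rangle> ** (\<Phi>\<langle>h,i\<rangle> ** X\<langle>i,j\<rangle>) ** (F\<langle>j,k\<rangle> ** ?D\<langle>k\<rangle>) = \<Phi>\<langle>h,i\<rangle> ** (Fi\<langle>j,k\<rangle> ** (X\<langle>i,j\<rangle> ** F\<langle>j,k\<rangle>)) ** ?D\<langle>k\<rangle>"
    using d by (simp add: reassoc commutes)
  also have "\<dots> = \<Phi>\<langle>h,i\<rangle> ** F\<langle>i,j\<rangle> ** (X\<langle>j,k\<rangle> ** ?D\<langle>k\<rangle>) ** Fi\<langle>i,j\<rangle>"
    unfolding r using d by (simp add: reassoc commutes)
  also have "Tr_factor k (Tr_factor i \<dots>) = Tr_factor i (\<Phi>\<langle>h,i\<rangle> ** F\<langle>i,j\<rangle> ** Tr_factor k (X\<langle>j,k\<rangle> ** ?D\<langle>k\<rangle>) ** Fi\<langle>i,j\<rangle>)"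
    using d by (simp add: Tr_factor_commute[of k i] Tr_left Tr_right)
  also have "\<dots> = ?D\<langle>h\<rangle>"
    using d by (simp add: Tr_X_D reassoc Tr_factor_second)
  finally show ?thesis
    by (metis d flip_square matrix_mul_assoc matrix_mul_lid)
qed

section \<open>Skew inverses of R-matrices\<close>

locale braided = invertible_pair F Fi + skew_pair F \<Psi>
  for F Fi \<Psi> :: "'n::finite end2" +
  assumes yb: "braid_rel F F"
begin

lemma yb_inverse: "braid_rel F Fi"
  unfolding braid_rel_inverse_iff using yb unfolding braid_rel_def by simp

lemma star_cancel: "star F A = star F B \<Longrightarrow> A = B"
  by (metis star_\<Phi> star_assoc star_flip(2))

lemma braided_sw: "braided (sw F) (sw Fi) (sw \<Psi>)"
  by (intro braided.intro invertible_pair_sw skew_pair_sw braided_axioms.intro braid_rel_sw yb_inverse)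

text \<open>Multiplication by F on the left is injective for \<open>star\<close>, so it suffices to
  compare the products of F with both sides. \<open>trace_exchange\<close> for X = F evaluates one
  of them, skew invertibility the other.\<close>

lemma skew_D: "\<Psi> ** act2 (Tr2 \<Psi>) = act1 (Tr2 \<Psi>) ** sw Fi"
proof -
  let ?D = "Tr2 \<Psi>"
  have d: "distinct [1::4, 2, 3, 4]" by simp
  note n = distinct4[OF d]
  have "(star F (act1 ?D ** sw Fi))\<langle>3,1\<rangle> = Tr_factor 4 ((F\<langle>3,4\<rangle> ** ?D\<langle>4\<rangle>) ** Fi\<langle>1,4::4\<rangle>)"
    by (simp add: n on_factors_mult on_factors_act1 on_factors_sw reassoc flip: Tr_star[of 3 4 1])
  also have "\<dots> = Tr_factor 4 (Fi\<langle>1,4\<rangle> ** (F\<langle>3,4\<rangle> ** ?D\<langle>4\<rangle>))"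
    by (rule Tr_factor_cyclic[OF acts_on_mult[OF acts_on_factors acts_on_factor] acts_on_factors]) (use n in auto)
  also have "\<dots> = flip\<langle>1,3\<rangle> ** ?D\<langle>1\<rangle>"
    using trace_exchange[OF skew_pair_axioms yb d] by (simp add: reassoc)
  also have "\<dots> = (flip ** act2 ?D)\<langle>3,1\<rangle>"
    by (simp add: n on_factors_mult on_factors_act2 flip_sym[of 1 3])
  finally have "star F (act1 ?D ** sw Fi) = flip ** act2 ?D"
    by (simp add: on_factors_inject n)
  also have "\<dots> = star F (\<Psi> ** act2 ?D)"
    by (simp add: star_act2_right star_X)
  finally show ?thesis using star_cancel by metis
qed

text \<open>The same cancellation with F and Fi exchanged in \<open>trace_exchange\<close>, which
  calls for the Yang-Baxter relation in the form \<open>yb_inverse\<close>.\<close>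

lemma D_skew: "act2 (Tr2 \<Psi>) ** \<Psi> = sw Fi ** act1 (Tr2 \<Psi>)"
proof -
  let ?D = "Tr2 \<Psi>"
  have d: "distinct [1::4, 2, 3, 4]" by simp
  note n = distinct4[OF d]
  interpret I: invertible_pair Fi F by (rule invertible_pair_commute)
  have "(star F (sw Fi ** act1 ?D))\<langle>1,3\<rangle> = Tr_factor 4 (F\<langle>1,4\<rangle> ** Fi\<langle>3,4\<rangle> ** ?D\<langle>4::4\<rangle>)"
    by (simp add: n on_factors_mult on_factors_act1 on_factors_sw reassoc flip: Tr_star[of 1 4 3])
  also have "\<dots> = (flip ** act1 ?D)\<langle>1,3\<rangle>"
    using I.trace_exchange[OF skew_pair_axioms yb_inverse d] by (simp add: n on_factors_mult on_factors_act1)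
  finally have "star F (sw Fi ** act1 ?D) = flip ** act1 ?D"
    by (simp add: on_factors_inject n)
  also have "\<dots> = star F (act2 ?D ** \<Psi>)"
    by (simp add: star_act2_left star_X flip_mult)
  finally show ?thesis using star_cancel by metis
qed

lemma skew_C: "\<Psi> ** act1 (Tr1 \<Psi>) = act2 (Tr1 \<Psi>) ** sw Fi"
proof -
  interpret S: braided "sw F" "sw Fi" "sw \<Psi>" by (rule braided_sw)
  show ?thesis using S.skew_D by (subst sw_inject[symmetric]) (simp add: sw_mult)
qed

lemma C_skew: "act1 (Tr1 \<Psi>) ** \<Psi> = sw Fi ** act2 (Tr1 \<Psi>)"
proof -
  interpret S: braided "sw F" "sw Fi" "sw \<Psi>" by (rule braided_sw)
  show ?thesis using S.D_skew by (subst sw_inject[symmetric]) (simp add: sw_mult)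
qed

text \<open>Solving \<open>skew_D\<close> for Fi gives Fi = q_2 \<Psi>_21 D_1. Since F_21 is inverse
  to \<Psi>_21 for \<open>star\<close>, the operator q_2 F_21 D_1 is inverse to Fi. The trace
  identities give the values of C and D for Fi; the last one also makes \<open>Tr1 \<Psi>\<close>
  invertible.\<close>

lemma inverse_skew:
  assumes Dq: "Tr2 \<Psi> ** q = mat 1"
  shows "skew_pair Fi (act2 q ** sw F ** act1 (Tr2 \<Psi>))" (is ?t1)
    "Tr1 (act2 q ** sw F ** act1 (Tr2 \<Psi>)) = q" (is ?t2)
    "Tr1 \<Psi> ** Tr2 (act2 q ** sw F ** act1 (Tr2 \<Psi>)) = mat 1" (is ?t3)
proof -
  let ?D = "Tr2 \<Psi>" and ?C = "Tr1 \<Psi>"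
  have qD: "q ** ?D = mat 1" using Dq by (simp add: matrix_left_right_inverse)
  have [simp]: "act1 ?D ** act1 q = mat 1" "act2 ?D ** act2 q = mat 1" "act1 q ** act1 ?D = mat 1" "act2 q ** act2 ?D = mat 1"
    by (simp_all add: Dq qD flip: act_mult)
  have [simp]: "act1 ?D ** (act1 q ** M) = M" "act2 ?D ** (act2 q ** M) = M" "act1 q ** (act1 ?D ** M) = M" "act2 q ** (act2 ?D ** M) = M" for M
    by (simp_all add: matrix_mul_assoc)
  have "act1 q ** (\<Psi> ** act2 ?D) = sw Fi" by (simp add: skew_D)
  then have "Fi = sw (act1 q ** (\<Psi> ** act2 ?D))" by simp
  then have Fi: "Fi = act2 q ** (sw \<Psi> ** act1 ?D)" by (simp add: sw_mult)
  have "star Fi (act2 q ** sw F ** act1 ?D) = act2 q ** (star (sw \<Psi>) (sw F) ** act1 ?D)"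
    unfolding Fi star_act_middle'
    by (simp add: star_act1_left star_act1_right star_act2_left star_act2_right reassoc)
  also have "\<dots> = act2 q ** flip ** act1 ?D"
    by (simp add: star_X reassoc flip: sw_star)
  also have "act2 q ** flip = flip ** act1 q"
    by (simp add: flip_mult)
  finally have "star Fi (act2 q ** sw F ** act1 ?D) = flip"
    by (simp add: reassoc)
  then show ?t1 by (simp add: skew_pair_def star_eq_flip_commute)
  have "Tr1 (sw F ** act1 ?D) = mat 1"
    using Tr_sw(1)[of "F ** act2 ?D"] by (simp add: sw_mult Tr2_X)
  then show ?t2 by (simp add: reassoc Tr1_act2)
  \<comment> \<open>Eliminating \<Psi> between \<open>skew_D\<close> and \<open>skew_C\<close> leads
    to q_1 C_2 F = F q_2 C_1, stated below as \<open>*\<close>. With it C and q pass through F, and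
    the trace becomes Tr_1 (F C_1) = 1.\<close>
  have \<Psi>: "\<Psi> = act1 ?D ** (sw Fi ** act2 q)"
    using arg_cong[OF skew_D, of "\<lambda>M. M ** act2 q"] by (simp add: reassoc)
  have "act1 q ** (act1 ?D ** (sw Fi ** act2 q) ** act1 ?C) = act1 q ** (act2 ?C ** sw Fi)"
    using skew_C unfolding \<Psi>[symmetric] by simp
  then have "sw F ** (sw Fi ** (act2 q ** act1 ?C)) ** sw F = sw F ** (act1 q ** (act2 ?C ** sw Fi)) ** sw F"
    by (simp add: reassoc)
  moreover have [simp]: "sw F ** (sw Fi ** M) = M" "sw Fi ** sw F = mat 1" for M
    by (simp_all add: matrix_mul_assoc F_Fi Fi_F flip: sw_mult)
  ultimately have "act2 q ** (act1 ?C ** sw F) = sw F ** (act1 q ** act2 ?C)"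
    by (simp add: reassoc)
  then have "sw (act2 q ** (act1 ?C ** sw F)) = sw (sw F ** (act1 q ** act2 ?C))" by simp
  then have *: "act1 q ** (act2 ?C ** F) = F ** (act2 q ** act1 ?C)" by (simp add: sw_mult)
  have "?C ** Tr2 (act2 q ** sw F ** act1 ?D) = ?C ** Tr2 (act2 q ** sw F) ** ?D"
    by (simp add: Tr2_act1 matrix_mul_assoc)
  also have "Tr2 (act2 q ** sw F) = Tr1 (act1 q ** F)"
    using Tr_sw(2)[of "act1 q ** F"] by (simp add: sw_mult)
  also have "?C ** Tr1 (act1 q ** F) ** ?D = Tr1 (act2 ?C ** (act1 q ** F) ** act2 ?D)"
    by (simp add: Tr1_act2)
  also have "act2 ?C ** (act1 q ** F) = F ** (act2 q ** act1 ?C)"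
    using * by (metis act1_act2 matrix_mul_assoc)
  also have "\<dots> ** act2 ?D = F ** act1 ?C"
    by (simp add: reassoc act1_act2)
  also have "Tr1 \<dots> = mat 1" using Tr1_X by (simp add: Tr1_cyclic)
  finally show ?t3 .
qed

end

text \<open>Only \<open>CE = 1\<close> and \<open>Dq = 1\<close> are required; in finite dimension the inverses are two-sided.\<close>

locale twist = P: skew_pair F \<Psi> + I: skew_pair Fi \<Psi>' + invertible_pair F Fi
  for F Fi \<Psi> \<Psi>' :: "'n::finite end2" and C D q E :: "'n end1" +
  assumes yb: "braid_rel F F"
    and C: "Tr1 \<Psi> = C" and D: "Tr2 \<Psi> = D" and q: "Tr1 \<Psi>' = q" and E: "Tr2 \<Psi>' = E"
    and Dq: "D ** q = mat 1" and CE: "C ** E = mat 1"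
begin

sublocale braided F Fi \<Psi> by unfold_locales (rule yb)

lemma qD: "q ** D = mat 1" and EC: "E ** C = mat 1"
  using Dq CE by (simp_all add: matrix_left_right_inverse)

text \<open>The data are symmetric under exchange of F and Fi, with (C, D, q, E) becoming (q, E, C,
  D); each result in this context thus has a second form.\<close>

lemma twist_commute: "twist Fi F \<Psi>' \<Psi> q E C D"
proof -
  interpret J: invertible_pair Fi F by (rule invertible_pair_commute)
  have "braid_rel Fi Fi"
    unfolding braid_rel_inverse_iff using braid_rel_conj[OF yb, of "1::3" 2 3] by (simp add: reassoc)
  then show ?thesis
    by unfold_locales (auto simp: C D q E EC qD)
qed

lemma cancel_act [simp]:
  "act1 D ** act1 q = mat 1" "act2 D ** act2 q = mat 1" "act1 q ** act1 D = mat 1" "act2 q ** act2 D = mat 1"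
  "act1 C ** act1 E = mat 1" "act2 C ** act2 E = mat 1" "act1 E ** act1 C = mat 1" "act2 E ** act2 C = mat 1"
  by (simp_all add: Dq qD CE EC flip: act_mult)

lemma cancel_act' [simp]:
  "act1 D ** (act1 q ** M) = M" "act2 D ** (act2 q ** M) = M" "act1 q ** (act1 D ** M) = M" "act2 q ** (act2 D ** M) = M"
  "act1 C ** (act1 E ** M) = M" "act2 C ** (act2 E ** M) = M" "act1 E ** (act1 C ** M) = M" "act2 E ** (act2 C ** M) = M"
  by (simp_all add: matrix_mul_assoc)

lemma cancel_factor [simp]:
  "D\<langle>i\<rangle> ** q\<langle>i\<rangle> = mat 1" "q\<langle>i\<rangle> ** D\<langle>i\<rangle> = mat 1" "C\<langle>i\<rangle> ** E\<langle>i\<rangle> = mat 1" "E\<langle>i\<rangle> ** C\<langle>i\<rangle> = mat 1"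
  by (simp_all add: Dq qD CE EC flip: on_factor_mult)

lemma cancel_factor' [simp]:
  "D\<langle>i\<rangle> ** (q\<langle>i\<rangle> ** M) = M" "q\<langle>i\<rangle> ** (D\<langle>i\<rangle> ** M) = M" "C\<langle>i\<rangle> ** (E\<langle>i\<rangle> ** M) = M" "E\<langle>i\<rangle> ** (C\<langle>i\<rangle> ** M) = M"
  by (simp_all add: matrix_mul_assoc)

text \<open>This and its three companions are the exchange relations solved for \<Psi>: it is
  F_21^-1 with D and q, or with E and C, on its legs, in either order.\<close>

lemma skew_inverse_D1: "\<Psi> = act1 D ** (sw Fi ** act2 q)"
  using arg_cong[OF skew_D, of "\<lambda>M. M ** act2 q"] by (simp add: reassoc D)

lemma skew_inverse_D2: "\<Psi> = act2 q ** (sw Fi ** act1 D)"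
  using arg_cong[OF D_skew, of "\<lambda>M. act2 q ** M"] by (simp add: reassoc D)

lemma skew_inverse_C1: "\<Psi> = act1 E ** (sw Fi ** act2 C)"
  using arg_cong[OF C_skew, of "\<lambda>M. act1 E ** M"] by (simp add: reassoc C)

lemma skew_inverse_C2: "\<Psi> = act2 C ** (sw Fi ** act1 E)"
  using arg_cong[OF skew_C, of "\<lambda>M. M ** act1 E"] by (simp add: reassoc C)

text \<open>The two expressions of \<Psi> through D and q must agree; clearing q from their equality
  shows that F commutes with D on both factors.\<close>

lemma factor_DD:
  assumes "i \<noteq> j" shows "F\<langle>i,j\<rangle> ** (D\<langle>i\<rangle> ** D\<langle>j\<rangle>) = D\<langle>i\<rangle> ** (D\<langle>j\<rangle> ** F\<langle>i,j\<rangle>)"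
proof -
  have "(act1 D ** (sw Fi ** act2 q))\<langle>j,i\<rangle> = (act2 q ** (sw Fi ** act1 D))\<langle>j,i\<rangle>"
    using skew_inverse_D1 skew_inverse_D2 by metis
  then have "D\<langle>j\<rangle> ** (Fi\<langle>i,j\<rangle> ** q\<langle>i\<rangle>) = q\<langle>i\<rangle> ** (Fi\<langle>i,j\<rangle> ** D\<langle>j\<rangle>)"
    using assms by (simp add: on_factors_mult on_factors_act1 on_factors_act2 on_factors_sw)
  then have "F\<langle>i,j\<rangle> ** (D\<langle>i\<rangle> ** (D\<langle>j\<rangle> ** (Fi\<langle>i,j\<rangle> ** q\<langle>i\<rangle>) ** (D\<langle>i\<rangle> ** F\<langle>i,j\<rangle>))) =
      F\<langle>i,j\<rangle> ** (D\<langle>i\<rangle> ** (q\<langle>i\<rangle> ** (Fi\<langle>i,j\<rangle> ** D\<langle>j\<rangle>) ** (D\<langle>i\<rangle> ** F\<langle>i,j\<rangle>)))"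
    by simp
  then show ?thesis using assms by (simp add: reassoc commutes)
qed

end

lemma (in braided) twist_if_D_invertible:
  assumes "Tr2 \<Psi> ** q = mat 1"
  shows "\<exists>\<Psi>'. twist F Fi \<Psi> \<Psi>' (Tr1 \<Psi>) (Tr2 \<Psi>) (Tr1 \<Psi>') (Tr2 \<Psi>')"
proof -
  let ?\<Psi>' = "act2 q ** sw F ** act1 (Tr2 \<Psi>)"
  have "twist F Fi \<Psi> ?\<Psi>' (Tr1 \<Psi>) (Tr2 \<Psi>) (Tr1 ?\<Psi>') (Tr2 ?\<Psi>')"
    using inverse_skew[OF assms] assms yb skew_pair_axioms invertible_pair_axioms
    by (intro twist.intro twist_axioms.intro) auto
  then show ?thesis by blast
qed

lemma (in braided) twist_exists:
  assumes "invertible (Tr1 \<Psi>) \<or> invertible (Tr2 \<Psi>)"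
  shows "\<exists>\<Psi>'. twist F Fi \<Psi> \<Psi>' (Tr1 \<Psi>) (Tr2 \<Psi>) (Tr1 \<Psi>') (Tr2 \<Psi>')"
proof -
  have "\<exists>q. Tr2 \<Psi> ** q = mat 1"
  proof (cases "invertible (Tr2 \<Psi>)")
    case False
    \<comment> \<open>In the mirror image the invertible trace is \<open>Tr2 (sw \<Psi>)\<close>,
      and the third conclusion of \<open>inverse_skew\<close> supplies a right inverse of the other
      trace, which is \<open>Tr2 \<Psi>\<close>.\<close>
    interpret S: braided "sw F" "sw Fi" "sw \<Psi>" by (rule braided_sw)
    from False obtain e where "Tr1 \<Psi> ** e = mat 1" using assms by (auto simp: invertible_def)
    then show ?thesis using S.inverse_skew(3)[of e] by auto
  qed (auto simp: invertible_def)
  then show ?thesis using twist_if_D_invertible by blast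
qed

section \<open>Conjugation by F\<close>

context twist
begin

text \<open>Read from right to left: write the flip as Tr_i \<Psi>_hi F_ij. Then F_ij F_jk carries
  Fi_jk X_jk to Fi_ij X_ij, the strand k closes to 1, and Fi_ij cancels F_ij, leaving \<Psi>_hi
  X_ij.\<close>

lemma partial_conj:
  fixes h j k :: "'l::finite"
  assumes X: "braid_rel X Fi" and d: "distinct [h, i, j, k]"
  shows "(star \<Psi> X)\<langle>h,j\<rangle> = Tr_factor k (Fi\<langle>j,k\<rangle> ** X\<langle>j,k\<rangle> ** F\<langle>h,k\<rangle> ** D\<langle>k\<rangle>) ** flip\<langle>h,j\<rangle>"
proof -
  note n = distinct4[OF d]
  interpret J: invertible_pair Fi F by (rule invertible_pair_commute)
  have "F\<langle>j,k\<rangle> ** (X\<langle>i,j\<rangle> ** Fi\<langle>j,k\<rangle>) = Fi\<langle>i,j\<rangle> ** (X\<langle>j,k\<rangle> ** F\<langle>i,j\<rangle>)"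
    by (rule J.braid_rel_conj[OF X]) (simp add: n)
  then have "F\<langle>i,j\<rangle> ** (F\<langle>j,k\<rangle> ** (X\<langle>i,j\<rangle> ** Fi\<langle>j,k\<rangle>)) ** F\<langle>j,k\<rangle> = F\<langle>i,j\<rangle> ** (Fi\<langle>i,j\<rangle> ** (X\<langle>j,k\<rangle> ** F\<langle>i,j\<rangle>)) ** F\<langle>j,k\<rangle>"
    by simp
  then have r1: "X\<langle>j,k\<rangle> ** (F\<langle>i,j\<rangle> ** F\<langle>j,k\<rangle>) = F\<langle>i,j\<rangle> ** (F\<langle>j,k\<rangle> ** X\<langle>i,j\<rangle>)"
    by (simp add: n reassoc)
  have r2: "Fi\<langle>j,k\<rangle> ** (F\<langle>i,j\<rangle> ** F\<langle>j,k\<rangle>) = F\<langle>i,j\<rangle> ** (F\<langle>j,k\<rangle> ** Fi\<langle>i,j\<rangle>)"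
    by (rule braid_rel_conj[OF yb]) (simp add: n)
  have r: "Fi\<langle>j,k\<rangle> ** (X\<langle>j,k\<rangle> ** (F\<langle>i,j\<rangle> ** F\<langle>j,k\<rangle>)) = F\<langle>i,j\<rangle> ** (F\<langle>j,k\<rangle> ** (Fi\<langle>i,j\<rangle> ** X\<langle>i,j\<rangle>))"
    unfolding r1 using arg_cong[OF r2, of "\<lambda>M. M ** X\<langle>i,j\<rangle>"] by (simp only: reassoc)
  have "Tr_factor k (Fi\<langle>j,k\<rangle> ** X\<langle>j,k\<rangle> ** F\<langle>h,k\<rangle> ** D\<langle>k\<rangle>) ** flip\<langle>h,j\<rangle> =
      Tr_factor k (Fi\<langle>j,k\<rangle> ** X\<langle>j,k\<rangle> ** F\<langle>h,k\<rangle> ** D\<langle>k\<rangle> ** flip\<langle>h,j\<rangle>)"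
    by (simp add: n Tr_right)
  also have "Fi\<langle>j,k\<rangle> ** X\<langle>j,k\<rangle> ** F\<langle>h,k\<rangle> ** D\<langle>k\<rangle> ** flip\<langle>h,j\<rangle> = Fi\<langle>j,k\<rangle> ** X\<langle>j,k\<rangle> ** flip\<langle>h,j\<rangle> ** (F\<langle>j,k\<rangle> ** D\<langle>k\<rangle>)"
    by (simp add: n reassoc flips)
  also have "Tr_factor k \<dots> = Tr_factor k (Tr_factor i (Fi\<langle>j,k\<rangle> ** X\<langle>j,k\<rangle> ** (\<Psi>\<langle>h,i\<rangle> ** F\<langle>i,j\<rangle>) ** (F\<langle>j,k\<rangle> ** D\<langle>k\<rangle>)))"
    by (simp add: n Tr_left Tr_right P.Tr_\<Phi>)
  also have "Fi\<langle>j,k\<rangle> ** X\<langle>j,k\<rangle> ** (\<Psi>\<langle>h,i\<rangle> ** F\<langle>i,j\<rangle>) ** (F\<langle>j,k\<rangle> ** D\<langle>k\<rangle>) =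
      \<Psi>\<langle>h,i\<rangle> ** (Fi\<langle>j,k\<rangle> ** (X\<langle>j,k\<rangle> ** (F\<langle>i,j\<rangle> ** F\<langle>j,k\<rangle>))) ** D\<langle>k\<rangle>"
    by (simp add: n reassoc commutes)
  also have "\<dots> = \<Psi>\<langle>h,i\<rangle> ** F\<langle>i,j\<rangle> ** (F\<langle>j,k\<rangle> ** D\<langle>k\<rangle>) ** (Fi\<langle>i,j\<rangle> ** X\<langle>i,j\<rangle>)"
    unfolding r by (simp add: n reassoc commutes)
  also have "Tr_factor k (Tr_factor i \<dots>) = Tr_factor i (\<Psi>\<langle>h,i\<rangle> ** F\<langle>i,j\<rangle> ** Tr_factor k (F\<langle>j,k\<rangle> ** D\<langle>k\<rangle>) ** (Fi\<langle>i,j\<rangle> ** X\<langle>i,j\<rangle>))"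
    by (simp add: n Tr_factor_commute[of k i] Tr_left Tr_right)
  also have "Tr_factor k (F\<langle>j,k\<rangle> ** D\<langle>k\<rangle>) = mat 1"
    using P.Tr_X_D[of j k] n by (simp add: D)
  also have "Tr_factor i (\<Psi>\<langle>h,i\<rangle> ** F\<langle>i,j\<rangle> ** mat 1 ** (Fi\<langle>i,j\<rangle> ** X\<langle>i,j\<rangle>)) = (star \<Psi> X)\<langle>h,j\<rangle>"
    by (simp add: n reassoc Tr_star)
  finally show ?thesis by simp
qed

text \<open>The loop Tr_k F_jk D_k = 1 is inserted between X_ij and F_ij. Compatibility moves X to
  the factors j, k, and Yang-Baxter moves the inverse after it.\<close>

lemma conj_loop:
  fixes j k :: "'l::finite"
  assumes X: "braid_rel X F" and d: "distinct [i, j, k]"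
  shows "(Fi ** X ** F)\<langle>i,j\<rangle> = Tr_factor k (D\<langle>k\<rangle> ** F\<langle>j,k\<rangle> ** F\<langle>i,j\<rangle> ** Fi\<langle>j,k\<rangle> ** X\<langle>j,k\<rangle>)"
proof -
  note n = distinct3[OF d]
  interpret J: invertible_pair Fi F by (rule invertible_pair_commute)
  have r1: "X\<langle>i,j\<rangle> ** F\<langle>j,k\<rangle> ** F\<langle>i,j\<rangle> = F\<langle>j,k\<rangle> ** F\<langle>i,j\<rangle> ** X\<langle>j,k\<rangle>"
    using X braid_rel_iff[OF d] by blast
  have r2: "F\<langle>j,k\<rangle> ** (F\<langle>i,j\<rangle> ** Fi\<langle>j,k\<rangle>) = Fi\<langle>i,j\<rangle> ** (F\<langle>j,k\<rangle> ** F\<langle>i,j\<rangle>)"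
    by (rule J.braid_rel_conj[OF yb_inverse d])
  have "(Fi ** X ** F)\<langle>i,j\<rangle> = Tr_factor k (Fi\<langle>i,j\<rangle> ** X\<langle>i,j\<rangle> ** (F\<langle>j,k\<rangle> ** D\<langle>k\<rangle>) ** F\<langle>i,j\<rangle>)"
    using P.Tr_X_D[of j k] by (simp add: n Tr_left Tr_right on_factors_mult D)
  also have "Fi\<langle>i,j\<rangle> ** X\<langle>i,j\<rangle> ** (F\<langle>j,k\<rangle> ** D\<langle>k\<rangle>) ** F\<langle>i,j\<rangle> = Fi\<langle>i,j\<rangle> ** (X\<langle>i,j\<rangle> ** F\<langle>j,k\<rangle> ** F\<langle>i,j\<rangle>) ** D\<langle>k\<rangle>"
    by (simp add: n reassoc commutes)
  also have "\<dots> = (F\<langle>j,k\<rangle> ** (F\<langle>i,j\<rangle> ** Fi\<langle>j,k\<rangle>)) ** X\<langle>j,k\<rangle> ** D\<langle>k\<rangle>"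
    unfolding r1 r2 by (simp add: reassoc)
  also have "Tr_factor k \<dots> = Tr_factor k (D\<langle>k\<rangle> ** ((F\<langle>j,k\<rangle> ** (F\<langle>i,j\<rangle> ** Fi\<langle>j,k\<rangle>)) ** X\<langle>j,k\<rangle>))"
    by (rule Tr_factor_cyclic, (rule acts_on_intros)+) (use n in auto)
  finally show ?thesis by (simp add: reassoc)
qed

text \<open>Both sides reduce to the loop of \<open>conj_loop\<close>. On the right, Fi_kj q_k = q_j
  \<Psi>_jk turns the trace over k into \<open>star \<Psi> X\<close>, which
  \<open>partial_conj\<close> opens into a new loop; D_j is pulled through F_jk by
  \<open>factor_DD\<close> and finally cancels q_j.\<close>

theorem conj_trace:
  fixes j k l :: "'l::finite"
  assumes X: "braid_rel X F" "braid_rel X Fi" and d: "distinct [i, j, k, l]"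
  shows "(Fi ** X ** F)\<langle>i,j\<rangle> = Tr_factor k (Tr_factor l (Fi\<langle>k,j\<rangle> ** q\<langle>k\<rangle> ** X\<langle>k,l\<rangle> ** D\<langle>l\<rangle> ** F\<langle>i,l\<rangle>))"
proof -
  note n = distinct4[OF d]
  have \<Psi>: "Fi\<langle>k,j\<rangle> ** q\<langle>k\<rangle> = q\<langle>j\<rangle> ** \<Psi>\<langle>j,k\<rangle>"
  proof -
    have "q\<langle>j\<rangle> ** \<Psi>\<langle>j,k\<rangle> = q\<langle>j\<rangle> ** (act1 D ** (sw Fi ** act2 q))\<langle>j,k\<rangle>"
      by (metis skew_inverse_D1)
    then show ?thesis by (simp add: n on_factors_mult on_factors_act1 on_factors_act2 on_factors_sw)
  qed
  have d': "distinct [j, i, l, k]" and d'': "distinct [i, j, k]" using d by auto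
  have "Tr_factor k (Tr_factor l (Fi\<langle>k,j\<rangle> ** q\<langle>k\<rangle> ** X\<langle>k,l\<rangle> ** D\<langle>l\<rangle> ** F\<langle>i,l\<rangle>)) =
      Tr_factor l (Tr_factor k (q\<langle>j\<rangle> ** (\<Psi>\<langle>j,k\<rangle> ** X\<langle>k,l\<rangle>) ** (D\<langle>l\<rangle> ** F\<langle>i,l\<rangle>)))"
    unfolding \<Psi> by (simp add: Tr_factor_commute[of k l] reassoc)
  also have "\<dots> = q\<langle>j\<rangle> ** Tr_factor l ((star \<Psi> X)\<langle>j,l\<rangle> ** (D\<langle>l\<rangle> ** F\<langle>i,l\<rangle>))"
    by (simp add: n Tr_left Tr_right Tr_star) (simp add: n Tr_left reassoc)
  also have "(star \<Psi> X)\<langle>j,l\<rangle> ** (D\<langle>l\<rangle> ** F\<langle>i,l\<rangle>) =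
      Tr_factor k (Fi\<langle>l,k\<rangle> ** X\<langle>l,k\<rangle> ** F\<langle>j,k\<rangle> ** D\<langle>k\<rangle> ** (flip\<langle>j,l\<rangle> ** (D\<langle>l\<rangle> ** F\<langle>i,l\<rangle>)))"
    unfolding partial_conj[OF X(2) d'] by (simp add: n Tr_right matrix_mul_assoc)
  also have "Fi\<langle>l,k\<rangle> ** X\<langle>l,k\<rangle> ** F\<langle>j,k\<rangle> ** D\<langle>k\<rangle> ** (flip\<langle>j,l\<rangle> ** (D\<langle>l\<rangle> ** F\<langle>i,l\<rangle>)) =
      (Fi\<langle>l,k\<rangle> ** X\<langle>l,k\<rangle>) ** (F\<langle>j,k\<rangle> ** D\<langle>k\<rangle> ** D\<langle>j\<rangle> ** F\<langle>i,j\<rangle> ** flip\<langle>j,l\<rangle>)"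
    by (simp add: n reassoc flips)
  \<comment> \<open>Fi_lk X_lk lives on the two traced factors only, so it may be moved to the end,
    where the flip carries it to j, k.\<close>
  also have "Tr_factor l (Tr_factor k \<dots>) =
      Tr_factor l (Tr_factor k ((F\<langle>j,k\<rangle> ** D\<langle>k\<rangle> ** D\<langle>j\<rangle> ** F\<langle>i,j\<rangle> ** flip\<langle>j,l\<rangle>) ** (Fi\<langle>l,k\<rangle> ** X\<langle>l,k\<rangle>)))"
    by (rule Tr_factor_cyclic2, (rule acts_on_intros)+) (use n in auto)
  also have "(F\<langle>j,k\<rangle> ** D\<langle>k\<rangle> ** D\<langle>j\<rangle> ** F\<langle>i,j\<rangle> ** flip\<langle>j,l\<rangle>) ** (Fi\<langle>l,k\<rangle> ** X\<langle>l,k\<rangle>) =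
      (F\<langle>j,k\<rangle> ** (D\<langle>j\<rangle> ** D\<langle>k\<rangle>)) ** F\<langle>i,j\<rangle> ** Fi\<langle>j,k\<rangle> ** X\<langle>j,k\<rangle> ** flip\<langle>j,l\<rangle>"
    by (simp add: n reassoc flips commute11 mult_left_commuteI[OF commute11])
  also have "F\<langle>j,k\<rangle> ** (D\<langle>j\<rangle> ** D\<langle>k\<rangle>) = D\<langle>j\<rangle> ** (D\<langle>k\<rangle> ** F\<langle>j,k\<rangle>)"
    by (rule factor_DD) (simp add: n)
  also have "Tr_factor l (Tr_factor k (D\<langle>j\<rangle> ** (D\<langle>k\<rangle> ** F\<langle>j,k\<rangle>) ** F\<langle>i,j\<rangle> ** Fi\<langle>j,k\<rangle> ** X\<langle>j,k\<rangle> ** flip\<langle>j,l\<rangle>)) =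
     Tr_factor k (D\<langle>j\<rangle> ** (D\<langle>k\<rangle> ** F\<langle>j,k\<rangle> ** F\<langle>i,j\<rangle> ** Fi\<langle>j,k\<rangle> ** X\<langle>j,k\<rangle>) ** Tr_factor l (flip\<langle>j,l\<rangle>))"
    by (simp add: n Tr_factor_commute[of l k] Tr_left reassoc)
  also have "q\<langle>j\<rangle> ** \<dots> = (Fi ** X ** F)\<langle>i,j\<rangle>"
    unfolding conj_loop[OF X(1) d''] by (simp add: n Tr_flip_factors Tr_left)
  finally show ?thesis by simp
qed

end

section \<open>The skew inverse of the twist\<close>

lemma flip_conj:
  fixes M :: "('n::finite, 'l::finite) endT"
  assumes "distinct [m, r, s]"
  shows "flip\<langle>m,r\<rangle> ** (X\<langle>s,r\<rangle> ** (flip\<langle>m,r\<rangle> ** M)) = X\<langle>s,m\<rangle> ** M"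
    and "flip\<langle>m,r\<rangle> ** (X\<langle>r,s\<rangle> ** (flip\<langle>m,r\<rangle> ** M)) = X\<langle>m,s\<rangle> ** M"
    and "flip\<langle>m,r\<rangle> ** (X\<langle>s,m\<rangle> ** (flip\<langle>m,r\<rangle> ** M)) = X\<langle>s,r\<rangle> ** M"
proof -
  note n = distinct3[OF assms]
  have P: "flip\<langle>m,r\<rangle> ** (flip\<langle>m,r\<rangle> ** M) = M" for M :: "('n, 'l) endT"
    by (simp add: n flip_square matrix_mul_assoc)
  have "P ** (A ** (P ** M)) = B ** M" if "P ** A = B ** P" "\<And>M :: ('n, 'l) endT. P ** (P ** M) = M" for P A B M :: "('n, 'l) endT"
    using that(2)[of M] ext2[OF that(1), of "P ** M"] by (simp add: reassoc)
  note * = this[OF _ P]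
  show "flip\<langle>m,r\<rangle> ** (X\<langle>s,r\<rangle> ** (flip\<langle>m,r\<rangle> ** M)) = X\<langle>s,m\<rangle> ** M"
    "flip\<langle>m,r\<rangle> ** (X\<langle>r,s\<rangle> ** (flip\<langle>m,r\<rangle> ** M)) = X\<langle>m,s\<rangle> ** M"
    "flip\<langle>m,r\<rangle> ** (X\<langle>s,m\<rangle> ** (flip\<langle>m,r\<rangle> ** M)) = X\<langle>s,r\<rangle> ** M"
    by (rule *, rule flip_moves; simp add: n)+
qed

text \<open>Contract the braid relation with \<open>G\<close> on both sides, then remove the two factors \<open>Fi\<close> by
  contraction with their skew inverse.\<close>

lemma (in invertible_pair) skew_inverse_exchange:
  assumes R: "skew_pair R G" "braid_rel R F" and Fi: "skew_pair Fi \<Psi>'"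
    and dist: "distinct [a, b, c, d, e, f, g]"
  shows "G\<langle>c,f\<rangle> ** \<Psi>'\<langle>g,c\<rangle> ** F\<langle>f,c\<rangle> = F\<langle>c,g\<rangle> ** \<Psi>'\<langle>c,f\<rangle> ** G\<langle>g,c\<rangle>"
proof -
  note n = distinct7[OF dist]
  interpret R: skew_pair R G by fact
  interpret I: skew_pair Fi \<Psi>' by fact
  have r: "Fi\<langle>c,d\<rangle> ** (R\<langle>b,c\<rangle> ** F\<langle>c,d\<rangle>) = F\<langle>b,c\<rangle> ** (R\<langle>c,d\<rangle> ** Fi\<langle>b,c\<rangle>)"
    by (rule braid_rel_conj[OF R(2)]) (simp add: n)
  have "Tr_factor d (Fi\<langle>c,d\<rangle> ** flip\<langle>a,c\<rangle> ** (F\<langle>c,d\<rangle> ** G\<langle>d,e\<rangle>)) =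
      Tr_factor d (Tr_factor b (Fi\<langle>c,d\<rangle> ** (G\<langle>a,b\<rangle> ** R\<langle>b,c\<rangle>) ** (F\<langle>c,d\<rangle> ** G\<langle>d,e\<rangle>)))"
    by (simp add: n Tr_left Tr_right R.Tr_\<Phi>)
  also have "Fi\<langle>c,d\<rangle> ** (G\<langle>a,b\<rangle> ** R\<langle>b,c\<rangle>) ** (F\<langle>c,d\<rangle> ** G\<langle>d,e\<rangle>) =
      G\<langle>a,b\<rangle> ** (Fi\<langle>c,d\<rangle> ** (R\<langle>b,c\<rangle> ** F\<langle>c,d\<rangle>)) ** G\<langle>d,e\<rangle>"
    by (simp add: n reassoc commutes)
  also have "\<dots> = G\<langle>a,b\<rangle> ** F\<langle>b,c\<rangle> ** (R\<langle>c,d\<rangle> ** G\<langle>d,e\<rangle>) ** Fi\<langle>b,c\<rangle>"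
    unfolding r by (simp add: n reassoc commutes)
  also have "Tr_factor d (Tr_factor b \<dots>) = Tr_factor b (G\<langle>a,b\<rangle> ** F\<langle>b,c\<rangle> ** flip\<langle>c,e\<rangle> ** Fi\<langle>b,c\<rangle>)"
    by (simp add: n Tr_factor_commute[of d b] Tr_left Tr_right R.Tr_X)
  finally have K1: "Tr_factor d (Fi\<langle>c,d\<rangle> ** flip\<langle>a,c\<rangle> ** (F\<langle>c,d\<rangle> ** G\<langle>d,e\<rangle>)) =
      Tr_factor b (G\<langle>a,b\<rangle> ** F\<langle>b,c\<rangle> ** flip\<langle>c,e\<rangle> ** Fi\<langle>b,c\<rangle>)" .

  \<comment> \<open>An auxiliary flip of trace 1 is inserted and written as Tr_e Fi_be \<Psi>'_ef.
    Conjugation by flip_ce turns Fi_be into Fi_bc, which produces the right-hand side of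
    \<open>K1\<close>.\<close>
  have "G\<langle>a,f\<rangle> ** F\<langle>f,c\<rangle> = Tr_factor b (flip\<langle>b,f\<rangle> ** G\<langle>a,f\<rangle> ** F\<langle>f,c\<rangle>)"
    by (simp add: n Tr_right Tr_flip_factors)
  also have "flip\<langle>b,f\<rangle> ** G\<langle>a,f\<rangle> ** F\<langle>f,c\<rangle> = G\<langle>a,b\<rangle> ** F\<langle>b,c\<rangle> ** flip\<langle>b,f\<rangle>"
    by (simp add: n reassoc flips)
  also have "\<dots> = Tr_factor e (G\<langle>a,b\<rangle> ** F\<langle>b,c\<rangle> ** (Fi\<langle>b,e\<rangle> ** \<Psi>'\<langle>e,f\<rangle>))"
    by (simp add: n Tr_left I.Tr_X)
  also have "G\<langle>a,b\<rangle> ** F\<langle>b,c\<rangle> ** (Fi\<langle>b,e\<rangle> ** \<Psi>'\<langle>e,f\<rangle>) =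
      G\<langle>a,b\<rangle> ** F\<langle>b,c\<rangle> ** flip\<langle>c,e\<rangle> ** Fi\<langle>b,c\<rangle> ** (flip\<langle>c,e\<rangle> ** \<Psi>'\<langle>e,f\<rangle>)"
    by (simp add: n reassoc flip_conj)
  also have "Tr_factor b (Tr_factor e \<dots>) =
      Tr_factor e (Tr_factor b (G\<langle>a,b\<rangle> ** F\<langle>b,c\<rangle> ** flip\<langle>c,e\<rangle> ** Fi\<langle>b,c\<rangle>) ** (flip\<langle>c,e\<rangle> ** \<Psi>'\<langle>e,f\<rangle>))"
    by (simp add: n Tr_factor_commute[of b e] Tr_right)
  also have "\<dots> = Tr_factor e (Tr_factor d (Fi\<langle>c,d\<rangle> ** flip\<langle>a,c\<rangle> ** F\<langle>c,d\<rangle> ** (G\<langle>d,e\<rangle> ** (flip\<langle>c,e\<rangle> ** \<Psi>'\<langle>e,f\<rangle>))))"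
    unfolding K1[symmetric] by (simp add: n Tr_right matrix_mul_assoc)
  also have "G\<langle>d,e\<rangle> ** (flip\<langle>c,e\<rangle> ** \<Psi>'\<langle>e,f\<rangle>) = \<Psi>'\<langle>c,f\<rangle> ** flip\<langle>c,e\<rangle> ** G\<langle>d,c\<rangle>"
    by (simp add: n reassoc flips commute22 mult_left_commuteI[OF commute22])
  also have "Tr_factor e (Tr_factor d (Fi\<langle>c,d\<rangle> ** flip\<langle>a,c\<rangle> ** F\<langle>c,d\<rangle> ** (\<Psi>'\<langle>c,f\<rangle> ** flip\<langle>c,e\<rangle> ** G\<langle>d,c\<rangle>))) =
      Tr_factor d (Fi\<langle>c,d\<rangle> ** flip\<langle>a,c\<rangle> ** F\<langle>c,d\<rangle> ** (\<Psi>'\<langle>c,f\<rangle> ** G\<langle>d,c\<rangle>))"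
    by (simp add: n Tr_factor_commute[of e d] Tr_left Tr_right Tr_flip_factors)
  finally have K2: "G\<langle>a,f\<rangle> ** F\<langle>f,c\<rangle> = Tr_factor d (Fi\<langle>c,d\<rangle> ** flip\<langle>a,c\<rangle> ** F\<langle>c,d\<rangle> ** (\<Psi>'\<langle>c,f\<rangle> ** G\<langle>d,c\<rangle>))" .

  \<comment> \<open>The same device: a flip of trace 1 turns G_cf into G_af, to which
    \<open>K2\<close> applies, and the remaining Fi_ad is contracted with \<Psi>'_ga.\<close>
  have "G\<langle>c,f\<rangle> ** \<Psi>'\<langle>g,c\<rangle> ** F\<langle>f,c\<rangle> = Tr_factor a (G\<langle>c,f\<rangle> ** flip\<langle>a,c\<rangle> ** (\<Psi>'\<langle>g,c\<rangle> ** F\<langle>f,c\<rangle>))"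
    by (simp add: n Tr_left Tr_right Tr_flip_factors reassoc)
  also have "G\<langle>c,f\<rangle> ** flip\<langle>a,c\<rangle> ** (\<Psi>'\<langle>g,c\<rangle> ** F\<langle>f,c\<rangle>) = \<Psi>'\<langle>g,a\<rangle> ** flip\<langle>a,c\<rangle> ** (G\<langle>a,f\<rangle> ** F\<langle>f,c\<rangle>)"
    by (simp add: n reassoc flips commute22 mult_left_commuteI[OF commute22])
  also have "\<dots> = Tr_factor d (\<Psi>'\<langle>g,a\<rangle> ** flip\<langle>a,c\<rangle> ** (Fi\<langle>c,d\<rangle> ** flip\<langle>a,c\<rangle> ** F\<langle>c,d\<rangle> ** (\<Psi>'\<langle>c,f\<rangle> ** G\<langle>d,c\<rangle>)))"
    unfolding K2 by (simp add: n Tr_left)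
  also have "\<Psi>'\<langle>g,a\<rangle> ** flip\<langle>a,c\<rangle> ** (Fi\<langle>c,d\<rangle> ** flip\<langle>a,c\<rangle> ** F\<langle>c,d\<rangle> ** (\<Psi>'\<langle>c,f\<rangle> ** G\<langle>d,c\<rangle>)) =
     (\<Psi>'\<langle>g,a\<rangle> ** Fi\<langle>a,d\<rangle>) ** (F\<langle>c,d\<rangle> ** \<Psi>'\<langle>c,f\<rangle> ** G\<langle>d,c\<rangle>)"
    by (simp add: n reassoc flip_conj)
  also have "Tr_factor a (Tr_factor d \<dots>) = Tr_factor d (flip\<langle>g,d\<rangle> ** (F\<langle>c,d\<rangle> ** \<Psi>'\<langle>c,f\<rangle> ** G\<langle>d,c\<rangle>))"
    by (simp add: n Tr_factor_commute[of a d] Tr_right I.Tr_\<Phi>)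
  also have "flip\<langle>g,d\<rangle> ** (F\<langle>c,d\<rangle> ** \<Psi>'\<langle>c,f\<rangle> ** G\<langle>d,c\<rangle>) = F\<langle>c,g\<rangle> ** \<Psi>'\<langle>c,f\<rangle> ** G\<langle>g,c\<rangle> ** flip\<langle>g,d\<rangle>"
    by (simp add: n reassoc flips)
  also have "Tr_factor d \<dots> = F\<langle>c,g\<rangle> ** \<Psi>'\<langle>c,f\<rangle> ** G\<langle>g,c\<rangle>"
    by (simp add: n Tr_left Tr_flip_factors)
  finally show ?thesis .
qed

text \<open>With \<Psi>' = C_2 F_21 E_1 inserted, the exchange identity multiplied by E and C at its
  ends contains only F and the new operator, and is their braid relation. C and E are left abstract
  so that it also applies with F and Fi exchanged.\<close>

lemma (in invertible_pair) braid_rel_skew_inverse: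
  assumes R: "skew_pair R G" "braid_rel R F" and Fi: "skew_pair Fi \<Psi>'"
    and \<Psi>': "\<Psi>' = act2 C ** (sw F ** act1 E)" and CE: "C ** E = mat 1"
  shows "braid_rel (act1 E ** sw G ** act2 C) F"
proof -
  note n = distinct7[of "1::7" 2 3 4 5 6 7, simplified]
  have EC: "E ** C = mat 1" using CE by (simp add: matrix_left_right_inverse)
  have c1: "C\<langle>i\<rangle> ** E\<langle>i\<rangle> = mat 1" "E\<langle>i\<rangle> ** C\<langle>i\<rangle> = mat 1" for i :: 7
    by (simp_all add: CE EC flip: on_factor_mult)
  then have c2: "C\<langle>i\<rangle> ** (E\<langle>i\<rangle> ** M) = M" "E\<langle>i\<rangle> ** (C\<langle>i\<rangle> ** M) = M" for i :: 7 and M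
    by (simp_all add: matrix_mul_assoc)
  have p: "\<Psi>'\<langle>i,j\<rangle> = C\<langle>j\<rangle> ** (F\<langle>j,i\<rangle> ** E\<langle>i\<rangle>)" if "i \<noteq> j" for i j :: 7
    using that by (simp add: \<Psi>' on_factors_mult on_factors_act1 on_factors_act2 on_factors_sw)
  \<comment> \<open>Only the labels 3, 6, 7 occur in the identity; the other four serve its proof as
    traced strands.\<close>
  have "distinct [1::7, 2, 3, 4, 5, 6, 7]" by simp
  from skew_inverse_exchange[OF R Fi this]
  have "E\<langle>6\<rangle> ** (G\<langle>3,6\<rangle> ** \<Psi>'\<langle>7,3\<rangle> ** F\<langle>6,3\<rangle>) ** C\<langle>7\<rangle> = E\<langle>6\<rangle> ** (F\<langle>3,7\<rangle> ** \<Psi>'\<langle>3,6\<rangle> ** G\<langle>7,3::7\<rangle>) ** C\<langle>7\<rangle>"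
    by simp
  moreover have "E\<langle>6\<rangle> ** (G\<langle>3,6\<rangle> ** \<Psi>'\<langle>7,3\<rangle> ** F\<langle>6,3\<rangle>) ** C\<langle>7::7\<rangle> =
      E\<langle>6\<rangle> ** (G\<langle>3,6\<rangle> ** (C\<langle>3\<rangle> ** (F\<langle>3,7\<rangle> ** F\<langle>6,3\<rangle>)))"
    by (simp add: p reassoc commute21 c1 c2)
  moreover have "E\<langle>6\<rangle> ** (F\<langle>3,7\<rangle> ** \<Psi>'\<langle>3,6\<rangle> ** G\<langle>7,3::7\<rangle>) ** C\<langle>7\<rangle> =
      F\<langle>3,7\<rangle> ** (F\<langle>6,3\<rangle> ** (E\<langle>3\<rangle> ** (G\<langle>7,3\<rangle> ** C\<langle>7\<rangle>)))"
  proof -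
    have "E\<langle>6\<rangle> ** (F\<langle>3,7\<rangle> ** (C\<langle>6\<rangle> ** M)) = F\<langle>3,7\<rangle> ** M" for M :: "('n, 7) endT"
    proof -
      have "F\<langle>3,7\<rangle> ** (E\<langle>6\<rangle> ** (C\<langle>6\<rangle> ** M)) = E\<langle>6\<rangle> ** (F\<langle>3,7\<rangle> ** (C\<langle>6\<rangle> ** M))"
        by (rule mult_left_commuteI[OF commute21]) simp_all
      then show ?thesis by (simp add: c2)
    qed
    then show ?thesis by (simp add: p reassoc)
  qed
  ultimately show ?thesis
    by (subst braid_rel_iff[of "6::7" 3 7])
       (simp_all add: on_factors_mult on_factors_act1 on_factors_act2 on_factors_sw reassoc)
qed

context twist
begin

lemma twist_sw: "twist (sw F) (sw Fi) (sw \<Psi>) (sw \<Psi>') D C E q"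
proof -
  interpret S: braided "sw F" "sw Fi" "sw \<Psi>" by (rule braided_sw)
  interpret I': skew_pair "sw Fi" "sw \<Psi>'" by (rule I.skew_pair_sw)
  show ?thesis by unfold_locales (auto simp: C D q E CE Dq S.yb)
qed

section \<open>Partial traces, and the skew inverse of the twist\<close>

text \<open>Insert the loop Tr_3 C_3 F_34 = 1 next to Fi_14; \<open>trace_exchange\<close> then
  evaluates the trace over 4 and leaves a flip.\<close>

lemma partial_trace_right:
  assumes X: "skew_pair X \<Phi>" "braid_rel X F"
  shows "Tr2 (Fi ** act2 (Tr2 \<Phi>)) = C ** Tr2 \<Phi>"
proof -
  have d: "distinct [1::4, 2, 3, 4]" by simp
  note n = distinct4[OF d]
  let ?D = "Tr2 \<Phi>"
  have "(Tr2 (Fi ** act2 ?D))\<langle>1::4\<rangle> = Tr_factor 4 (Fi\<langle>1,4\<rangle> ** ?D\<langle>4\<rangle>)"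
    by (simp add: Tr_factor_second flip: on_factors_mult on_factors_act2[of 1 4])
  also have "\<dots> = Tr_factor 4 (Tr_factor 3 (Fi\<langle>1,4\<rangle> ** (C\<langle>3\<rangle> ** F\<langle>3,4\<rangle>) ** ?D\<langle>4\<rangle>))"
    using P.Tr_C_X[of 3 "4::4"] by (simp add: Tr_left Tr_right C)
  also have "Fi\<langle>1,4\<rangle> ** (C\<langle>3\<rangle> ** F\<langle>3,4\<rangle>) ** ?D\<langle>4::4\<rangle> = C\<langle>3\<rangle> ** (Fi\<langle>1,4\<rangle> ** F\<langle>3,4\<rangle> ** ?D\<langle>4\<rangle>)"
    by (simp add: n reassoc commutes)
  also have "Tr_factor 4 (Tr_factor 3 \<dots>) = Tr_factor 3 (C\<langle>3\<rangle> ** (flip\<langle>1,3\<rangle> ** ?D\<langle>1\<rangle>))"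
    unfolding trace_exchange[OF X d, symmetric] by (simp add: Tr_factor_commute[of 4 3] Tr_left)
  also have "C\<langle>3\<rangle> ** (flip\<langle>1,3\<rangle> ** ?D\<langle>1\<rangle>) = flip\<langle>1,3\<rangle> ** (C ** ?D)\<langle>1::4\<rangle>"
    by (simp add: n on_factor_mult flips reassoc)
  also have "Tr_factor 3 \<dots> = (C ** ?D)\<langle>1\<rangle>"
    by (simp add: Tr_right Tr_flip_factors)
  finally show ?thesis by (simp add: on_factor_inject)
qed

text \<open>The other compatibility relation, through \<open>trace_exchange\<close> for Fi, gives
  the same trace with the factors in the opposite order.\<close>

lemma partial_trace_right':
  assumes X: "skew_pair X \<Phi>" "braid_rel X Fi"
  shows "Tr2 (Fi ** act2 (Tr2 \<Phi>)) = Tr2 \<Phi> ** C"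
proof -
  interpret J: invertible_pair Fi F by (rule invertible_pair_commute)
  have d: "distinct [1::4, 2, 3, 4]" by simp
  note n = distinct4[OF d]
  let ?D = "Tr2 \<Phi>"
  have "(Tr2 (Fi ** act2 ?D))\<langle>3::4\<rangle> = Tr_factor 4 (Fi\<langle>3,4\<rangle> ** ?D\<langle>4\<rangle>)"
    by (simp add: Tr_factor_second flip: on_factors_mult on_factors_act2[of 3 4])
  also have "\<dots> = Tr_factor 4 (Tr_factor 1 ((C\<langle>1\<rangle> ** F\<langle>1,4\<rangle>) ** (Fi\<langle>3,4\<rangle> ** ?D\<langle>4\<rangle>)))"
    using P.Tr_C_X[of 1 "4::4"] by (simp add: Tr_right C)
  also have "\<dots> = Tr_factor 1 (C\<langle>1\<rangle> ** (flip\<langle>1,3\<rangle> ** ?D\<langle>1\<rangle>))"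
    unfolding J.trace_exchange[OF X d, symmetric] by (simp add: Tr_factor_commute[of 4 1] Tr_left reassoc)
  also have "C\<langle>1\<rangle> ** (flip\<langle>1,3\<rangle> ** ?D\<langle>1\<rangle>) = flip\<langle>1,3\<rangle> ** (C\<langle>3\<rangle> ** ?D\<langle>1::4\<rangle>)"
    by (simp add: n flips reassoc)
  also have "C\<langle>3\<rangle> ** ?D\<langle>1\<rangle> = ?D\<langle>1\<rangle> ** C\<langle>3::4\<rangle>"
    by (simp add: commute11)
  also have "flip\<langle>1,3\<rangle> ** (?D\<langle>1\<rangle> ** C\<langle>3\<rangle>) = ?D\<langle>3::4\<rangle> ** flip\<langle>1,3\<rangle> ** C\<langle>3\<rangle>"
    by (simp add: n reassoc flips)
  also have "Tr_factor 1 \<dots> = (?D ** C)\<langle>3\<rangle>"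
    by (simp add: Tr_left Tr_right Tr_flip_factors on_factor_mult)
  finally show ?thesis by (simp add: on_factor_inject)
qed

text \<open>\<open>partial_trace_right\<close> under both symmetries at once: reversal of the
  factors and exchange of F and Fi, whereby E takes the place of C.\<close>

lemma partial_trace_left:
  assumes X: "skew_pair X \<Phi>" "braid_rel X F"
  shows "Tr1 (act1 (Tr1 \<Phi>) ** F) = E ** Tr1 \<Phi>"
proof -
  interpret X: skew_pair X \<Phi> by fact
  interpret J: invertible_pair Fi F by (rule invertible_pair_commute)
  interpret T: twist "sw Fi" "sw F" "sw \<Psi>'" "sw \<Psi>" E q D C
    by (rule twist.twist_sw[OF twist_commute])
  have "Tr2 (sw F ** act2 (Tr2 (sw \<Phi>))) = E ** Tr2 (sw \<Phi>)"
    by (rule T.partial_trace_right[OF X.skew_pair_sw J.braid_rel_sw[OF X(2)]])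
  moreover have "Tr2 (sw F ** act2 (Tr1 \<Phi>)) = Tr1 (F ** act1 (Tr1 \<Phi>))"
    by (simp add: sw_mult flip: Tr_sw(2))
  ultimately show ?thesis by (simp add: Tr1_cyclic)
qed

text \<open>In (a), Fi_32 q_3 = q_2 \<Psi>_23 and D_4 F_14 = \<Psi>'_41 D_1, so the double trace is
  a product for \<open>star\<close>.\<close>

lemma twisted_star:
  assumes "braid_rel R F" "braid_rel R Fi"
  shows "sw (Fi ** R ** F) = act1 q ** star (star \<Psi> R) \<Psi>' ** act2 D"
proof -
  have d: "distinct [1::4, 2, 3, 4]" by simp
  note n = distinct4[OF d]
  interpret T: twist Fi F \<Psi>' \<Psi> q E C D by (rule twist_commute)
  have 1: "Fi\<langle>3,2\<rangle> ** q\<langle>3\<rangle> = q\<langle>2\<rangle> ** \<Psi>\<langle>2,3::4\<rangle>"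
    using arg_cong[OF skew_inverse_D1, of "on_factors 2 (3::4)"]
    by (simp add: on_factors_mult on_factors_act1 on_factors_act2 on_factors_sw)
  have 2: "D\<langle>4\<rangle> ** F\<langle>1,4\<rangle> = \<Psi>'\<langle>4,1::4\<rangle> ** D\<langle>1\<rangle>"
    using arg_cong[OF T.skew_inverse_C1, of "on_factors 4 (1::4)"]
    by (simp add: on_factors_mult on_factors_act1 on_factors_act2 on_factors_sw reassoc)
  have "(sw (Fi ** R ** F))\<langle>2,1::4\<rangle> = Tr_factor 3 (Tr_factor 4 ((Fi\<langle>3,2\<rangle> ** q\<langle>3\<rangle>) ** R\<langle>3,4\<rangle> ** (D\<langle>4\<rangle> ** F\<langle>1,4\<rangle>)))"
    unfolding on_factors_sw conj_trace[OF assms d] by (simp add: reassoc)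
  also have "\<dots> = Tr_factor 4 (Tr_factor 3 (q\<langle>2\<rangle> ** (\<Psi>\<langle>2,3\<rangle> ** R\<langle>3,4\<rangle>) ** (\<Psi>'\<langle>4,1\<rangle> ** D\<langle>1\<rangle>)))"
    unfolding 1 2 by (simp add: Tr_factor_commute[of 3 4] reassoc)
  also have "Tr_factor 3 (q\<langle>2\<rangle> ** (\<Psi>\<langle>2,3\<rangle> ** R\<langle>3,4\<rangle>) ** (\<Psi>'\<langle>4,1\<rangle> ** D\<langle>1::4\<rangle>)) =
      q\<langle>2\<rangle> ** ((star \<Psi> R)\<langle>2,4\<rangle> ** \<Psi>'\<langle>4,1\<rangle>) ** D\<langle>1\<rangle>"
    by (simp add: Tr_left Tr_right Tr_star) (simp add: reassoc)
  also have "Tr_factor 4 \<dots> = (act1 q ** star (star \<Psi> R) \<Psi>' ** act2 D)\<langle>2,1\<rangle>"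
    by (simp add: Tr_left Tr_right Tr_star on_factors_mult on_factors_act1 on_factors_act2)
  finally show ?thesis by (simp add: on_factors_inject)
qed

text \<open>The inverse of \<open>star (star \<Psi> R) \<Psi>'\<close> is
  \<open>star (star Fi G) F\<close>. Of the operators on the legs, D and q meet and cancel in the
  contracted factor, while the outer ones cancel across the flip.\<close>

lemma twisted_skew_pair:
  assumes R: "skew_pair R G" "braid_rel R F" "braid_rel R Fi"
  shows "skew_pair (Fi ** R ** F) (sw (act1 q ** star (star Fi G) F ** act2 D))"
proof -
  interpret R: skew_pair R G by fact
  have "star (star (star \<Psi> R) \<Psi>') (star (star Fi G) F) = star \<Psi> (star R (star (star \<Psi>' Fi) (star G F)))"
    by (simp add: star_assoc)
  also have "\<dots> = star \<Psi> (star (star R G) F)"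
    by (simp add: I.star_\<Phi> star_assoc)
  also have "\<dots> = flip" by (simp add: R.star_X P.star_\<Phi>)
  finally have *: "star (star (star \<Psi> R) \<Psi>') (star (star Fi G) F) = flip" .
  have "star (act1 q ** star (star \<Psi> R) \<Psi>' ** act2 D) (act1 q ** star (star Fi G) F ** act2 D) =
      act1 q ** (star (star (star \<Psi> R) \<Psi>') (act1 D ** (act1 q ** star (star Fi G) F)) ** act2 D)"
    by (simp only: star_act_middle star_act1_left star_act2_right matrix_mul_assoc)
  also have "\<dots> = act1 q ** (flip ** act2 D)" by (simp add: *)
  also have "\<dots> = flip" by (simp add: flip_mult)
  finally have "star (sw (Fi ** R ** F)) (act1 q ** star (star Fi G) F ** act2 D) = flip"
    unfolding twisted_star[OF R(2,3)] .
  then have "sw (star (sw (Fi ** R ** F)) (act1 q ** star (star Fi G) F ** act2 D)) = flip" by simp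
  then have "star (sw (act1 q ** star (star Fi G) F ** act2 D)) (Fi ** R ** F) = flip"
    by (simp add: sw_star)
  then show ?thesis by (simp add: skew_pair_def star_eq_flip_commute)
qed

text \<open>Formula (a) for Fi places C_k before and E_l after its argument. The choice Q_kl = E_k
  G_lk C_l makes them cancel, which leaves the bare contraction of F, G and Fi.\<close>

lemma star_conj:
  assumes R: "skew_pair R G" "braid_rel R F" "braid_rel R Fi"
  shows "star (star Fi G) F = F ** (act1 E ** sw G ** act2 C) ** Fi"
proof -
  have d: "distinct [1::4, 2, 3, 4]" by simp
  note n = distinct4[OF d]
  interpret T: twist Fi F \<Psi>' \<Psi> q E C D by (rule twist_commute)
  let ?Q = "act1 E ** sw G ** act2 C"
  have Q: "braid_rel ?Q F"
    by (rule braid_rel_skew_inverse[OF R(1,2) I.skew_pair_axioms T.skew_inverse_D2 CE])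
  have Q': "braid_rel ?Q Fi"
    by (rule T.braid_rel_skew_inverse[OF R(1,3) P.skew_pair_axioms skew_inverse_C2 CE])
  have "(F ** ?Q ** Fi)\<langle>1,2::4\<rangle> = Tr_factor 3 (Tr_factor 4 (F\<langle>3,2\<rangle> ** G\<langle>4,3\<rangle> ** Fi\<langle>1,4\<rangle>))"
    unfolding T.conj_trace[OF Q' Q d]
    by (simp add: on_factors_mult on_factors_act1 on_factors_act2 on_factors_sw reassoc)
  also have "F\<langle>3,2\<rangle> ** G\<langle>4,3\<rangle> ** Fi\<langle>1,4::4\<rangle> = F\<langle>3,2\<rangle> ** (G\<langle>4,3\<rangle> ** Fi\<langle>1,4\<rangle>)"
    by (simp add: reassoc)
  also have "Tr_factor 3 (Tr_factor 4 \<dots>) = Tr_factor 3 (F\<langle>3,2\<rangle> ** (star Fi G)\<langle>1,3\<rangle>)"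
  proof -
    have "Tr_factor 4 (G\<langle>4,3\<rangle> ** Fi\<langle>1,4::4\<rangle>) = Tr_factor 4 (Fi\<langle>1,4\<rangle> ** G\<langle>4,3\<rangle>)"
      by (rule Tr_factor_cyclic, (rule acts_on_intros)+) auto
    then show ?thesis by (simp add: Tr_left Tr_star)
  qed
  also have "\<dots> = Tr_factor 3 ((star Fi G)\<langle>1,3\<rangle> ** F\<langle>3,2::4\<rangle>)"
    by (rule Tr_factor_cyclic, (rule acts_on_intros)+) auto
  also have "\<dots> = (star (star Fi G) F)\<langle>1,2\<rangle>"
    by (simp add: Tr_star)
  finally show ?thesis by (simp add: on_factors_inject)
qed

text \<open>For the first trace D closes the strand of F to 1, and Fi is absorbed by
  \<open>partial_trace_right'\<close>; for the second, q does the same to Fi, and F is absorbed by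
  \<open>partial_trace_left\<close>.\<close>

lemma twisted_traces:
  assumes R: "skew_pair R G" "braid_rel R F" "braid_rel R Fi"
  shows "Tr1 (sw (act1 q ** star (star Fi G) F ** act2 D)) = q ** Tr2 G ** C"
    and "Tr2 (sw (act1 q ** star (star Fi G) F ** act2 D)) = E ** Tr1 G ** D"
proof -
  have "Tr2 (star (star Fi G) F ** act2 D) = Tr2 (star (star Fi G) (F ** act2 D))"
    by (simp add: star_act2_right)
  also have "\<dots> = Tr2 (star Fi G)"
    using P.Tr2_X by (simp add: Tr2_star D)
  also have "\<dots> = Tr2 G ** C"
    by (simp add: Tr2_star partial_trace_right'[OF R(1,3)])
  finally show "Tr1 (sw (act1 q ** star (star Fi G) F ** act2 D)) = q ** Tr2 G ** C"
    by (simp add: Tr2_act1 reassoc)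
  have "Tr1 (act1 q ** star (star Fi G) F) = Tr1 (star (act1 q ** Fi) (star G F))"
    by (simp add: star_act1_left star_assoc)
  also have "\<dots> = Tr1 (star G F)"
    using I.Tr1_X by (simp add: Tr1_star q)
  also have "\<dots> = E ** Tr1 G"
    by (simp add: Tr1_star partial_trace_left[OF R(1,2)])
  finally show "Tr2 (sw (act1 q ** star (star Fi G) F ** act2 D)) = E ** Tr1 G ** D"
    by (simp add: Tr1_act2)
qed

end

section \<open>Compatible pairs\<close>

lemma is_skew_inverse_iff: "is_skew_inverse X \<Psi> \<longleftrightarrow> skew_pair X \<Psi>"
  by (simp add: is_skew_inverse_def skew_pair_def Tr_star on_factors_inject)

lemma skew_inverse_eq:
  assumes "skew_pair X \<Phi>" shows "skew_inverse X = \<Phi>"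
proof -
  interpret skew_pair X \<Phi> by fact
  have "\<Psi> = \<Phi>" if "skew_pair X \<Psi>" for \<Psi>
    using skew_pair.star_\<Phi>[OF that] star_X by (metis star_assoc star_flip)
  then show ?thesis
    unfolding skew_inverse_def is_skew_inverse_iff using assms by blast
qed

lemma skew_inverse_traces:
  assumes "skew_pair X \<Phi>" shows "C_op X = Tr1 \<Phi>" "D_op X = Tr2 \<Phi>"
  by (simp_all add: C_op_def D_op_def skew_inverse_eq[OF assms])

lemma skew_invertible_iff: "skew_invertible X \<longleftrightarrow> (\<exists>\<Phi>. skew_pair X \<Phi>)"
  by (simp add: skew_invertible_def is_skew_inverse_iff)

lemma strict_skew_invertible_iff:
  "skew_pair X \<Phi> \<Longrightarrow> strict_skew_invertible X \<longleftrightarrow> invertible (Tr1 \<Phi>) \<or> invertible (Tr2 \<Phi>)"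
  by (auto simp: strict_skew_invertible_def skew_invertible_iff skew_inverse_traces)

lemma compatible_pairD:
  assumes "compatible_pair R F"
  shows "invertible_pair F (matrix_inv F)" "braid_rel F F" "braid_rel R F" "braid_rel R (matrix_inv F)"
proof -
  have "invertible F" using assms by (simp add: compatible_pair_def R_matrix_def)
  then show p: "invertible_pair F (matrix_inv F)"
    unfolding invertible_def matrix_inv_def invertible_pair_def by (rule someI_ex)
  show "braid_rel F F" "braid_rel R F"
    using assms by (simp_all add: compatible_pair_def R_matrix_def braid_rel_def Let_def)
  show "braid_rel R (matrix_inv F)"
    using assms by (simp add: invertible_pair.braid_rel_inverse_iff[OF p] compatible_pair_def Let_def)
qed

text \<open>Uniqueness of skew inverses identifies the traces of the constructed \<Psi>' with
  \<open>C_op\<close> and \<open>D_op\<close> of the inverse.\<close>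

lemma compatible_pair_twist:
  assumes "compatible_pair R F" "strict_skew_invertible F"
  obtains \<Psi> \<Psi>' where "twist F (matrix_inv F) \<Psi> \<Psi>'
    (C_op F) (D_op F) (C_op (matrix_inv F)) (D_op (matrix_inv F))"
proof -
  from assms(2) obtain \<Psi> where \<Psi>: "skew_pair F \<Psi>"
    by (auto simp: strict_skew_invertible_def skew_invertible_iff)
  have "braided F (matrix_inv F) \<Psi>"
    by (intro braided.intro braided_axioms.intro compatible_pairD(1,2)[OF assms(1)] \<Psi>)
  from braided.twist_exists[OF this] obtain \<Psi>' where
    t: "twist F (matrix_inv F) \<Psi> \<Psi>' (Tr1 \<Psi>) (Tr2 \<Psi>) (Tr1 \<Psi>') (Tr2 \<Psi>')"
    using assms(2) strict_skew_invertible_iff[OF \<Psi>] by blast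
  then have "skew_pair (matrix_inv F) \<Psi>'" by (simp add: twist_def)
  with t \<Psi> show ?thesis by (intro that) (simp add: skew_inverse_traces)
qed

theorem lemma3p6:
  fixes R F :: "complex^('n::finite \<times> 'n)^('n \<times> 'n)"
  assumes "compatible_pair R F"
  shows
    "(strict_skew_invertible F \<longrightarrow>
        (on_factors 1 2 (twisted R F) :: ('n, 4) endT) =
          Tr_factor 3 (Tr_factor 4
            (on_factors 3 2 (matrix_inv F) ** on_factor 3 (C_op (matrix_inv F)) **
             on_factors 3 4 R ** on_factor 4 (D_op F) ** on_factors 1 4 F)))
     \<and>
     (skew_invertible R \<and> strict_skew_invertible F \<longrightarrow>
        skew_invertible (twisted R F) \<and>
        (on_factors 1 2 (skew_inverse (twisted R F)) :: ('n, 4) endT) =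
          on_factor 2 (C_op (matrix_inv F)) **
          Tr_factor 3 (Tr_factor 4
            (on_factors 2 3 (matrix_inv F) ** on_factors 3 4 (skew_inverse R) ** on_factors 4 1 F)) **
          on_factor 1 (D_op F) \<and>
        (on_factors 1 2 (skew_inverse (twisted R F)) :: ('n, 2) endT) =
          on_factor 2 (C_op (matrix_inv F)) ** on_factors 2 1 F **
          on_factor 2 (D_op (matrix_inv F)) ** on_factors 1 2 (skew_inverse R) **
          on_factor 1 (C_op F) ** on_factors 2 1 (matrix_inv F) ** on_factor 1 (D_op F))
     \<and>
     (skew_invertible R \<and> strict_skew_invertible F \<longrightarrow>
        C_op (twisted R F) = C_op (matrix_inv F) ** D_op R ** C_op F \<and>
        D_op (twisted R F) = D_op (matrix_inv F) ** C_op R ** D_op F \<and>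
        (strict_skew_invertible R \<longrightarrow> strict_skew_invertible (twisted R F)))"
proof -
  let ?Fi = "matrix_inv F" and ?C = "C_op F" and ?D = "D_op F"
    and ?q = "C_op (matrix_inv F)" and ?E = "D_op (matrix_inv F)"
  note RF = compatible_pairD(3,4)[OF assms]
  have a: "(on_factors 1 2 (twisted R F) :: ('n, 4) endT) =
          Tr_factor 3 (Tr_factor 4
            (on_factors 3 2 ?Fi ** on_factor 3 ?q ** on_factors 3 4 R ** on_factor 4 ?D ** on_factors 1 4 F))"
    if F: "strict_skew_invertible F"
  proof -
    obtain \<Psi> \<Psi>' where "twist F ?Fi \<Psi> \<Psi>' ?C ?D ?q ?E"
      using compatible_pair_twist[OF assms F] .
    then show ?thesis unfolding twisted_def by (rule twist.conj_trace[OF _ RF]) simp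
  qed
  have bc: "skew_invertible (twisted R F) \<and>
        (on_factors 1 2 (skew_inverse (twisted R F)) :: ('n, 4) endT) =
          on_factor 2 ?q **
          Tr_factor 3 (Tr_factor 4
            (on_factors 2 3 ?Fi ** on_factors 3 4 (skew_inverse R) ** on_factors 4 1 F)) **
          on_factor 1 ?D \<and>
        (on_factors 1 2 (skew_inverse (twisted R F)) :: ('n, 2) endT) =
          on_factor 2 ?q ** on_factors 2 1 F ** on_factor 2 ?E ** on_factors 1 2 (skew_inverse R) **
          on_factor 1 ?C ** on_factors 2 1 ?Fi ** on_factor 1 ?D \<and>
        C_op (twisted R F) = ?q ** D_op R ** ?C \<and>
        D_op (twisted R F) = ?E ** C_op R ** ?D \<and>
        (strict_skew_invertible R \<longrightarrow> strict_skew_invertible (twisted R F))"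
    if R: "skew_invertible R" and F: "strict_skew_invertible F"
  proof -
    obtain \<Psi> \<Psi>' where "twist F ?Fi \<Psi> \<Psi>' ?C ?D ?q ?E"
      using compatible_pair_twist[OF assms F] .
    then interpret twist F ?Fi \<Psi> \<Psi>' ?C ?D ?q ?E .
    obtain G where G: "skew_pair R G" using R by (auto simp: skew_invertible_iff)
    define Z where "Z = star (star ?Fi G) F"
    define \<Phi> where "\<Phi> = sw (act1 ?q ** Z ** act2 ?D)"
    have \<Phi>: "skew_pair (twisted R F) \<Phi>"
      unfolding \<Phi>_def Z_def twisted_def by (rule twisted_skew_pair[OF G RF])
    have tr: "Tr1 \<Phi> = ?q ** Tr2 G ** ?C" "Tr2 \<Phi> = ?E ** Tr1 G ** ?D"
      unfolding \<Phi>_def Z_def by (rule twisted_traces[OF G RF])+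
    \<comment> \<open>The chain 2-3, 3-4, 4-1 is the threefold product read from factor 2 to factor
      1, whence the reversed labels of Z.\<close>
    have Z4: "Z\<langle>2,1\<rangle> = Tr_factor 3 (Tr_factor 4 (?Fi\<langle>2,3\<rangle> ** G\<langle>3,4\<rangle> ** F\<langle>4,1::4\<rangle>))"
      by (simp add: Z_def Tr_factor_commute[of 3 4] Tr_right Tr_star)
    have b1: "\<Phi>\<langle>1,2\<rangle> = ?q\<langle>2\<rangle> ** Z\<langle>2,1\<rangle> ** ?D\<langle>1::4\<rangle>"
      by (simp add: \<Phi>_def on_factors_sw on_factors_mult on_factors_act1 on_factors_act2)
    have b2: "\<Phi>\<langle>1,2\<rangle> = ?q\<langle>2\<rangle> ** F\<langle>2,1\<rangle> ** ?E\<langle>2\<rangle> ** G\<langle>1,2\<rangle> ** ?C\<langle>1\<rangle> ** ?Fi\<langle>2,1\<rangle> ** ?D\<langle>1::2\<rangle>"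
      by (simp add: \<Phi>_def Z_def star_conj[OF G RF] on_factors_sw on_factors_mult
          on_factors_act1 on_factors_act2 reassoc)
    \<comment> \<open>C of the twist is D_R between invertible operators, and D of the twist is C_R
      likewise, so strictness is inherited whichever trace of R is invertible.\<close>
    have inv: "invertible ?C" "invertible ?D" "invertible ?q" "invertible ?E"
      using CE EC Dq qD unfolding invertible_def by blast+
    have "strict_skew_invertible (twisted R F)" if "strict_skew_invertible R"
      using that inv unfolding strict_skew_invertible_iff[OF G] strict_skew_invertible_iff[OF \<Phi>] tr
      by (auto intro!: invertible_mult)
    then show ?thesis
      using \<Phi> b1 b2 tr unfolding Z4 skew_inverse_eq[OF \<Phi>] skew_inverse_eq[OF G]
        skew_inverse_traces[OF \<Phi>] skew_inverse_traces[OF G] skew_invertible_iff by blast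
  qed
  show ?thesis using a bc by blast
qed

end
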